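(* The problem $\omega$-$\textsc{Stability}$ is in $\mathrm{P}$ for co-graphs; that is, there is a deterministic polynomial-time algorithm that, given any co-graph $G$, decides whether $G$ is $\omega$-stable.
   Context: Graphs are finite, undirected, simple, without loops. Co-graphs are defined recursively: a single-vertex graph $(\{v\},\emptyset)$ is a co-graph; if $G_1$ and $G_2$ are (vertex-disjoint) co-graphs, then so are their disjoint union $G_1\cup G_2$ and their join $G_1+G_2$ (the disjoint union together with all edges between $V(G_1)$ and $V(G_2)$). $\omega(G)$ is the size of a maximum clique. $G$ is $\omega$-stable if $\omega(G-e)=\omega(G)$ for every edge $e\in E(G)$, where $G-e$ is $G$ with the edge $e$ deleted; $\omega$-$\textsc{Stability}$ is the set of $\omega$-stable graphs. Running time is polynomial in the size of the encoding of $G$. *)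

theory Defs
  imports Main "HOL-Library.Ramsey" "HOL-Computational_Algebra.Polynomial"
begin

section \<open>Graphs and co-graphs\<close>

text \<open>A graph is a pair of its vertex set and its edge set; edges are two-element sets of
  vertices, so there are neither loops nor multiple edges.\<close>

type_synonym 'a graph = "'a set \<times> 'a set set"

abbreviation verts :: "'a graph \<Rightarrow> 'a set" where "verts \<equiv> fst"
abbreviation edges :: "'a graph \<Rightarrow> 'a set set" where "edges \<equiv> snd"

definition simple_graph :: "'a graph \<Rightarrow> bool" where
  "simple_graph G \<longleftrightarrow> finite (verts G) \<and> edges G \<subseteq> [verts G]\<^bsup>2\<^esup>"

definition graph_union :: "'a graph \<Rightarrow> 'a graph \<Rightarrow> 'a graph" where
  "graph_union G H = (verts G \<union> verts H, edges G \<union> edges H)"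

definition graph_join :: "'a graph \<Rightarrow> 'a graph \<Rightarrow> 'a graph" where
  "graph_join G H = (verts G \<union> verts H,
     edges G \<union> edges H \<union> {{u, v} | u v. u \<in> verts G \<and> v \<in> verts H})"

definition delete_edge :: "'a graph \<Rightarrow> 'a set \<Rightarrow> 'a graph" where
  "delete_edge G e = (verts G, edges G - {e})"

inductive cograph :: "'a graph \<Rightarrow> bool" where
  single: "cograph ({v}, {})"
| union: "cograph G \<Longrightarrow> cograph H \<Longrightarrow> verts G \<inter> verts H = {} \<Longrightarrow> cograph (graph_union G H)"
| join: "cograph G \<Longrightarrow> cograph H \<Longrightarrow> verts G \<inter> verts H = {} \<Longrightarrow> cograph (graph_join G H)"

lemma cograph_simple_graph: "cograph G \<Longrightarrow> simple_graph G"
proof (induction rule: cograph.induct)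
  case (join G H)
  then have "{u, v} \<in> [verts G \<union> verts H]\<^bsup>2\<^esup>" if "u \<in> verts G" "v \<in> verts H" for u v
  proof -
    have "u \<noteq> v" using join.hyps that by blast
    with that show ?thesis by (simp add: nsets_def)
  qed
  with join show ?case
    by (auto simp: simple_graph_def graph_join_def nsets_def)
qed (auto simp: simple_graph_def graph_union_def nsets_def)

definition clique_number :: "'a graph \<Rightarrow> nat"  (\<open>\<omega>\<close>) where
  "\<omega> G = Max {card K | K. K \<subseteq> verts G \<and> clique K (edges G)}"

definition omega_stability :: "'a graph set" where
  "omega_stability = {G. simple_graph G \<and> (\<forall>e\<in>edges G. \<omega> (delete_edge G e) = \<omega> G)}"

text \<open>The encodings of a graph are its adjacency matrices, written row by row, with respect to
  all orderings of its vertices.\<close>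

definition adjacency_code :: "'a list \<Rightarrow> 'a graph \<Rightarrow> bool list" where
  "adjacency_code vs G = concat (map (\<lambda>u. map (\<lambda>v. {u, v} \<in> edges G) vs) vs)"

definition graph_codes :: "'a graph \<Rightarrow> bool list set" where
  "graph_codes G = {adjacency_code vs G | vs. distinct vs \<and> set vs = verts G}"


section \<open>Deterministic multitape Turing machines\<close>

datatype move = Lt | St | Rt

text \<open>States and tape symbols are natural numbers below \<open>states\<close> and \<open>symbols\<close>. Symbol 0 is the
  blank; 1 and 2 are the input symbols for False and True. The transition function takes the
  current state and the symbols scanned on the tapes, and returns the new state and, for every
  tape, the symbol to write and the head movement.\<close>

record turing_machine =
  tapes :: nat
  states :: nat
  symbols :: nat
  start :: nat
  accept :: nat
  reject :: nat
  trans :: "nat \<Rightarrow> nat list \<Rightarrow> nat \<times> (nat \<times> move) list"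

definition wf_tm :: "turing_machine \<Rightarrow> bool" where
  "wf_tm M \<longleftrightarrow>
     tapes M \<ge> 1 \<and> symbols M \<ge> 3 \<and>
     start M < states M \<and> accept M < states M \<and> reject M < states M \<and> accept M \<noteq> reject M \<and>
     (\<forall>q syms. q < states M \<and> length syms = tapes M \<and> (\<forall>s\<in>set syms. s < symbols M) \<longrightarrow>
        (case trans M q syms of (q', acts) \<Rightarrow>
           q' < states M \<and> length acts = tapes M \<and> (\<forall>(s, d)\<in>set acts. s < symbols M)))"

text \<open>A tape is infinite in both directions and is given together with the position of its head.\<close>

type_synonym tape = "int \<times> (int \<Rightarrow> nat)"
type_synonym config = "nat \<times> tape list"

fun scanned :: "tape \<Rightarrow> nat" where
  "scanned (p, t) = t p"

fun shift :: "move \<Rightarrow> int \<Rightarrow> int" where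
  "shift Lt p = p - 1"
| "shift St p = p"
| "shift Rt p = p + 1"

fun act :: "nat \<times> move \<Rightarrow> tape \<Rightarrow> tape" where
  "act (s, d) (p, t) = (shift d p, t(p := s))"

fun step :: "turing_machine \<Rightarrow> config \<Rightarrow> config" where
  "step M (q, ts) =
     (if q = accept M \<or> q = reject M then (q, ts)
      else case trans M q (map scanned ts) of (q', acts) \<Rightarrow> (q', map2 act acts ts))"

definition input_tape :: "bool list \<Rightarrow> tape" where
  "input_tape x =
     (0, \<lambda>i. if 0 \<le> i \<and> i < int (length x) then (if x ! nat i then 2 else 1) else 0)"

definition init_config :: "turing_machine \<Rightarrow> bool list \<Rightarrow> config" where
  "init_config M x = (start M, input_tape x # replicate (tapes M - 1) (0, \<lambda>_. 0))"

definition answers_within :: "turing_machine \<Rightarrow> bool list \<Rightarrow> bool \<Rightarrow> nat \<Rightarrow> bool" where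
  "answers_within M x b T \<longleftrightarrow>
     (\<exists>t\<le>T. fst ((step M ^^ t) (init_config M x)) = (if b then accept M else reject M))"

text \<open>\<open>A\<close> is in P for instances from \<open>C\<close>: a single machine runs in polynomial time and answers
  correctly on every encoding of every instance in \<open>C\<close>; nothing is required of it on other
  inputs.\<close>

definition in_P_for :: "('i \<Rightarrow> bool list set) \<Rightarrow> 'i set \<Rightarrow> 'i set \<Rightarrow> bool" where
  "in_P_for codes A C \<longleftrightarrow>
     (\<exists>M (p :: nat poly). wf_tm M \<and>
        (\<forall>G\<in>C. \<forall>x\<in>codes G. answers_within M x (G \<in> A) (poly p (length x))))"

end

theory Submission
  imports Defs
begin

text \<open>In a co-graph every maximal clique meets every maximal independent set, by induction along
  unions and joins. Hence removing a maximal independent set lowers the clique number by exactly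
  one, and the number of rounds in which the greedy algorithm exhausts a co-graph by maximal
  independent sets is its clique number. This also applies to all induced subgraphs. An edge is
  critical iff both its ends lie in every maximum clique, that is, iff the deletion of either
  end lowers the clique number; two such vertices are always adjacent. So \<open>G\<close> is stable iff
  \<open>\<omega> (G - v) < \<omega> G\<close> for at most one vertex \<open>v\<close>. The Turing machine counts the greedy rounds for
  \<open>G\<close> and for every \<open>G - v\<close>.\<close>

section \<open>Structured programs for Turing machines\<close>

text \<open>The input is a bare adjacency matrix in an arbitrary vertex order, so no decomposition
  into unions and joins is at hand. Counting greedy rounds needs none: only the correctness proof
  uses the co-graph structure. Testing the edges one by one in this way would fail, because
  co-graphs are not closed under edge deletion: a 4-cycle minus an edge is a path on four vertices,
  where greedy may first pick the two ends and then takes three rounds in all, although the clique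
  number is two. Deleting vertices does no such harm, and this is why stability is rephrased in
  terms of vertices. Choosing greedily in the order of the matrix also suits a machine: one pass
  over a row, in parallel with a tape that has one cell per vertex, decides that vertex. The machine
  itself is compiled from a small while language, so that running times can be bounded program by
  program.\<close>

datatype com =
    Skip
  | Do "nat list \<Rightarrow> (nat \<times> move) list"
  | Seq com com  (infixr \<open>;;\<close> 60)
  | While "nat list \<Rightarrow> bool" com

definition stay :: "nat list \<Rightarrow> (nat \<times> move) list" where
  "stay syms = map (\<lambda>s. (s, St)) syms"

text \<open>The result depends only on the remaining program and the scanned symbols, as a
  transition function must. Discarding a finished first part and testing a loop each take a step
  that leaves the tapes alone; the additive constants in the running times come from these
  steps.\<close>

primrec com_trans :: "com \<Rightarrow> nat list \<Rightarrow> com \<times> (nat \<times> move) list" where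
  "com_trans Skip syms = (Skip, stay syms)"
| "com_trans (Do f) syms = (Skip, f syms)"
| "com_trans (c ;; d) syms =
     (if c = Skip then (d, stay syms)
      else (fst (com_trans c syms) ;; d, snd (com_trans c syms)))"
| "com_trans (While b c) syms = (if b syms then c ;; While b c else Skip, stay syms)"

definition com_step :: "com \<times> tape list \<Rightarrow> com \<times> tape list" where
  "com_step = (\<lambda>(c, ts).
     (fst (com_trans c (map scanned ts)), map2 act (snd (com_trans c (map scanned ts))) ts))"

definition runs :: "com \<Rightarrow> tape list \<Rightarrow> nat \<Rightarrow> tape list \<Rightarrow> bool" where
  "runs c ts T ts' \<longleftrightarrow> (\<exists>t\<le>T. (com_step ^^ t) (c, ts) = (Skip, ts'))"

lemma act_scanned_St [simp]: "act (scanned t, St) t = t"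
  by (cases t) auto

lemma map2_act_stay [simp]: "map2 act (stay (map scanned ts)) ts = ts"
  by (induction ts) (auto simp: stay_def)

lemma com_step_Skip [simp]: "com_step (Skip, ts) = (Skip, ts)"
  by (simp add: com_step_def)

lemma com_step_funpow_Skip [simp]: "(com_step ^^ t) (Skip, ts) = (Skip, ts)"
  by (induction t) auto

text \<open>Once \<open>c\<close> has finished, \<open>com_step\<close> idles on
  \<open>Skip\<close>, whereas \<open>c ;; d\<close> moves on to \<open>d\<close>. So
  \<open>t'\<close> is taken to be the moment at which \<open>c\<close> first becomes
  \<open>Skip\<close>, possibly before \<open>t\<close>; the \<open>Suc\<close> is the step that
  discards this \<open>Skip\<close>.\<close>

lemma com_step_funpow_Seq:
  assumes "(com_step ^^ t) (c, ts) = (Skip, ts')"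
  shows "\<exists>t'\<le>t. (com_step ^^ Suc t') (c ;; d, ts) = (d, ts')"
  using assms
proof (induction t arbitrary: c ts)
  case 0
  then show ?case by (simp add: com_step_def)
next
  case (Suc t)
  show ?case
  proof (cases "c = Skip")
    case True
    with Suc.prems have "ts = ts'" by (simp del: funpow.simps)
    with True show ?thesis by (intro exI[of _ 0]) (simp add: com_step_def)
  next
    case False
    obtain c1 ts1 where 1: "com_step (c, ts) = (c1, ts1)" by fastforce
    with Suc.prems have "(com_step ^^ t) (c1, ts1) = (Skip, ts')"
      by (simp add: funpow_swap1)
    from Suc.IH[OF this] obtain t' where "t' \<le> t" "(com_step ^^ Suc t') (c1 ;; d, ts1) = (d, ts')"
      by blast
    moreover have "com_step (c ;; d, ts) = (c1 ;; d, ts1)"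
      using 1 False by (auto simp: com_step_def)
    ultimately show ?thesis
      by (intro exI[of _ "Suc t'"]) (simp add: funpow_swap1)
  qed
qed

section \<open>Rules for bounding the running time of programs\<close>

lemma runs_mono: "runs c ts T ts' \<Longrightarrow> T \<le> T' \<Longrightarrow> runs c ts T' ts'"
  unfolding runs_def by (meson le_trans)

lemma runs_Do: "map2 act (f (map scanned ts)) ts = ts' \<Longrightarrow> runs (Do f) ts 1 ts'"
  unfolding runs_def by (intro exI[of _ 1]) (simp add: com_step_def)

lemma runs_Seq:
  assumes "runs c ts T1 ts1" and "runs d ts1 T2 ts2"
  shows "runs (c ;; d) ts (T1 + T2 + 1) ts2"
proof -
  from assms(1) obtain t where "t \<le> T1" "(com_step ^^ t) (c, ts) = (Skip, ts1)"
    by (auto simp: runs_def)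
  with com_step_funpow_Seq obtain t1 where 1: "t1 \<le> T1" "(com_step ^^ Suc t1) (c ;; d, ts) = (d, ts1)"
    by (meson le_trans)
  from assms(2) obtain t2 where 2: "t2 \<le> T2" "(com_step ^^ t2) (d, ts1) = (Skip, ts2)"
    by (auto simp: runs_def)
  have "(com_step ^^ (t2 + Suc t1)) (c ;; d, ts) = (Skip, ts2)"
    unfolding funpow_add using 1 2 by simp
  with 1 2 show ?thesis
    unfolding runs_def by (intro exI[of _ "t2 + Suc t1"]) simp
qed

lemma runs_While_False: "\<not> b (map scanned ts) \<Longrightarrow> runs (While b c) ts 1 ts"
  unfolding runs_def by (intro exI[of _ 1]) (simp add: com_step_def)

lemma runs_While_True:
  assumes "b (map scanned ts)" and "runs (c ;; While b c) ts T ts'"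
  shows "runs (While b c) ts (Suc T) ts'"
proof -
  have "com_step (While b c, ts) = (c ;; While b c, ts)"
    using assms(1) by (simp add: com_step_def)
  moreover from assms(2) obtain t where "t \<le> T" "(com_step ^^ t) (c ;; While b c, ts) = (Skip, ts')"
    by (auto simp: runs_def)
  ultimately show ?thesis
    unfolding runs_def by (intro exI[of _ "Suc t"]) (simp add: funpow_swap1)
qed

text \<open>The explicit configuration \<open>\<sigma> i\<close> before pass \<open>i\<close> serves
  as loop invariant. The \<open>+ 2\<close> per pass pays for the test and for discarding the
  finished body, the last \<open>+ 1\<close> for the failing test.\<close>

lemma runs_While:
  assumes "\<And>i. i < n \<Longrightarrow> b (map scanned (\<sigma> i))"
    and "\<And>i. i < n \<Longrightarrow> runs c (\<sigma> i) T (\<sigma> (Suc i))"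
    and "\<not> b (map scanned (\<sigma> n))"
  shows "runs (While b c) (\<sigma> 0) (n * (T + 2) + 1) (\<sigma> n)"
proof -
  \<comment> \<open>Induction on the number \<open>k\<close> of passes still to come, since the
    rules unfold a loop from the front.\<close>
  have "runs (While b c) (\<sigma> (n - k)) (k * (T + 2) + 1) (\<sigma> n)" if "k \<le> n" for k
    using that
  proof (induction k)
    case 0
    show ?case using runs_While_False[of b "\<sigma> n"] assms(3) by simp
  next
    case (Suc k)
    then have *: "n - Suc k < n" "Suc (n - Suc k) = n - k" by auto
    have "runs (c ;; While b c) (\<sigma> (n - Suc k)) (T + (k * (T + 2) + 1) + 1) (\<sigma> n)"
    proof (rule runs_Seq)
      show "runs c (\<sigma> (n - Suc k)) T (\<sigma> (n - k))"
        using assms(2)[OF *(1)] by (simp only: *(2))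
      show "runs (While b c) (\<sigma> (n - k)) (k * (T + 2) + 1) (\<sigma> n)"
        using Suc by simp
    qed
    from runs_While_True[OF assms(1)[OF *(1)] this] show ?case
      by (simp add: algebra_simps)
  qed
  from this[of n] show ?thesis by simp
qed

text \<open>The states of the machine for a program \<open>c\<close> are the programs that may remain to be executed
  when \<open>c\<close> is run.\<close>

primrec coms :: "com \<Rightarrow> com set" where
  "coms Skip = {Skip}"
| "coms (Do f) = {Do f, Skip}"
| "coms (c ;; d) = (\<lambda>x. x ;; d) ` coms c \<union> coms d"
| "coms (While b c) = {While b c, Skip} \<union> (\<lambda>x. x ;; While b c) ` coms c"

lemma finite_coms: "finite (coms c)"
  by (induction c) auto

lemma coms_refl: "c \<in> coms c"
  by (induction c) auto

lemma com_trans_coms: "d \<in> coms c \<Longrightarrow> fst (com_trans d syms) \<in> coms c"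
proof (induction c arbitrary: d)
  case (While b c)
  then consider "d = While b c" | "d = Skip" | x where "d = x ;; While b c" "x \<in> coms c"
    by auto
  then show ?case
    using While.IH by cases (auto simp: coms_refl)
qed (auto simp: coms_refl)

definition wf_acts :: "nat \<Rightarrow> nat \<Rightarrow> (nat list \<Rightarrow> (nat \<times> move) list) \<Rightarrow> bool" where
  "wf_acts k m f \<longleftrightarrow> (\<forall>syms. length syms = k \<and> (\<forall>s\<in>set syms. s < m) \<longrightarrow>
     length (f syms) = k \<and> (\<forall>(s, d)\<in>set (f syms). s < m))"

primrec wf_com :: "nat \<Rightarrow> nat \<Rightarrow> com \<Rightarrow> bool" where
  "wf_com k m Skip = True"
| "wf_com k m (Do f) = wf_acts k m f"
| "wf_com k m (c ;; d) = (wf_com k m c \<and> wf_com k m d)"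
| "wf_com k m (While b c) = wf_com k m c"

lemma wf_acts_stay: "wf_acts k m stay"
  by (auto simp: wf_acts_def stay_def)

lemma wf_acts_com_trans: "wf_com k m c \<Longrightarrow> wf_acts k m (\<lambda>syms. snd (com_trans c syms))"
proof (induction c)
  case (Seq c d)
  then show ?case by (cases "c = Skip") (simp_all add: wf_acts_stay)
qed (simp_all add: wf_acts_stay)

lemma wf_com_coms: "wf_com k m c \<Longrightarrow> \<forall>d\<in>coms c. wf_com k m d"
proof (induction c)
  case (Seq c1 c2)
  from Seq.prems have "wf_com k m c1" "wf_com k m c2" by simp_all
  from Seq.IH(1)[OF this(1)] Seq.IH(2)[OF this(2)] \<open>wf_com k m c2\<close> show ?case
    by (simp add: ball_Un)
next
  case (While b c)
  from While.prems have "wf_com k m c" by simp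
  from While.IH[OF this] \<open>wf_com k m c\<close> show ?case
    by (simp add: ball_Un)
qed simp_all

text \<open>The answer may be any predicate \<open>verdict\<close> of the symbols scanned at the
  end: the machine evaluates it in one extra transition out of \<open>Skip\<close>, hence the bound
  \<open>p + 1\<close>.\<close>

theorem in_P_for_com:
  fixes p :: "nat poly"
  assumes wf: "wf_com k m c" "k \<ge> 1" "m \<ge> 3"
    and run: "\<And>G x. G \<in> C \<Longrightarrow> x \<in> codes G \<Longrightarrow>
      \<exists>ts. runs c (input_tape x # replicate (k - 1) (0, \<lambda>_. 0)) (poly p (length x)) ts \<and>
           verdict (map scanned ts) = (G \<in> A)"
  shows "in_P_for codes A C"
proof -
  obtain h where h: "bij_betw h (coms c) {0..<card (coms c)}"
    using ex_bij_betw_finite_nat finite_coms by blast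
  \<comment> \<open>The shift by 2 frees the states 0 and 1 for accepting and rejecting.\<close>
  define enc where "enc d = h d + 2" for d
  define dec where "dec q = inv_into (coms c) h (q - 2)" for q
  define M where "M = \<lparr>tapes = k, states = card (coms c) + 2, symbols = m, start = enc c,
    accept = 0, reject = 1, trans = (\<lambda>q syms.
      if q < 2 then (q, stay syms)
      else if dec q = Skip then (if verdict syms then 0 else 1, stay syms)
      else (enc (fst (com_trans (dec q) syms)), snd (com_trans (dec q) syms)))\<rparr>"
  have dec_enc: "dec (enc d) = d" if "d \<in> coms c" for d
    using h that by (auto simp: dec_def enc_def bij_betw_def inv_into_f_f)
  have enc_less: "enc d < card (coms c) + 2" if "d \<in> coms c" for d
    using h that by (auto simp: enc_def bij_betw_def)
  have dec_in: "dec q \<in> coms c" if "2 \<le> q" "q < card (coms c) + 2" for q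
  proof -
    have "q - 2 \<in> h ` coms c" using h that by (auto simp: bij_betw_def)
    then show ?thesis unfolding dec_def by (rule inv_into_into)
  qed
  have "wf_tm M"
  proof -
    have "case trans M q syms of (q', acts) \<Rightarrow>
           q' < states M \<and> length acts = tapes M \<and> (\<forall>(s, d)\<in>set acts. s < symbols M)"
      if q: "q < states M" "length syms = tapes M" "\<forall>s\<in>set syms. s < symbols M" for q syms
    proof (cases "q < 2 \<or> dec q = Skip")
      case True
      with q wf_acts_stay[of k m] show ?thesis by (auto simp: M_def wf_acts_def)
    next
      case False
      with q have "dec q \<in> coms c" by (auto simp: M_def intro: dec_in)
      moreover from this have "wf_acts k m (\<lambda>syms. snd (com_trans (dec q) syms))"
        using wf wf_com_coms wf_acts_com_trans by blast
      ultimately show ?thesis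
        using False q enc_less[OF com_trans_coms] by (auto simp: M_def wf_acts_def)
    qed
    then show ?thesis
      using wf enc_less[OF coms_refl] by (auto simp: wf_tm_def M_def)
  qed
  moreover have sim: "\<exists>t'\<le>Suc t. fst ((step M ^^ t') (enc d, ts)) = (if verdict (map scanned ts') then 0 else 1)"
    if "d \<in> coms c" "(com_step ^^ t) (d, ts) = (Skip, ts')" for t d ts ts'
    using that
  proof (induction t arbitrary: d ts)
    case 0
    then show ?case using dec_enc[of Skip]
      by (intro exI[of _ 1]) (auto simp: M_def enc_def)
  next
    case (Suc t)
    show ?case
    proof (cases "d = Skip")
      case True
      with Suc.prems have "ts = ts'" by (simp del: funpow.simps)
      with Suc.prems(1) True show ?thesis using dec_enc[of Skip]
        by (intro exI[of _ 1]) (auto simp: M_def enc_def)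
    next
      case False
      obtain d1 ts1 where 1: "com_step (d, ts) = (d1, ts1)" by fastforce
      with Suc.prems have 2: "(com_step ^^ t) (d1, ts1) = (Skip, ts')"
        by (simp add: funpow_swap1)
      have 3: "d1 \<in> coms c"
        using 1 Suc.prems com_trans_coms by (auto simp: com_step_def)
      have "step M (enc d, ts) = (enc d1, ts1)"
        using 1 False dec_enc[OF Suc.prems(1)] by (auto simp: M_def com_step_def enc_def)
      moreover obtain t' where "t' \<le> Suc t"
        "fst ((step M ^^ t') (enc d1, ts1)) = (if verdict (map scanned ts') then 0 else 1)"
        using Suc.IH[OF 3 2] by blast
      ultimately show ?thesis
        by (intro exI[of _ "Suc t'"]) (simp add: funpow_swap1)
    qed
  qed
  have "answers_within M x (G \<in> A) (poly (p + 1) (length x))" if Gx: "G \<in> C" "x \<in> codes G" for G x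
  proof -
    obtain ts t where t: "t \<le> poly p (length x)" "verdict (map scanned ts) = (G \<in> A)"
        "(com_step ^^ t) (c, input_tape x # replicate (k - 1) (0, \<lambda>_. 0)) = (Skip, ts)"
      using run[OF Gx] by (auto simp: runs_def)
    obtain t' where "t' \<le> Suc t" "fst ((step M ^^ t') (init_config M x)) = (if G \<in> A then 0 else 1)"
      using sim[OF coms_refl t(3)] t(2) by (auto simp: init_config_def M_def)
    with t(1) show ?thesis
      unfolding answers_within_def by (intro exI[of _ t']) (auto simp: M_def)
  qed
  ultimately show ?thesis
    unfolding in_P_for_def by blast
qed

section \<open>Cliques and independent sets of co-graphs\<close>

text \<open>Cliques are taken with respect to a relation and not a graph: negating the relation
  turns them into independent sets, and an induced subgraph is just a subset.\<close>

definition is_clique :: "('a \<Rightarrow> 'a \<Rightarrow> bool) \<Rightarrow> 'a set \<Rightarrow> bool" where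
  "is_clique R K \<longleftrightarrow> (\<forall>x\<in>K. \<forall>y\<in>K. x \<noteq> y \<longrightarrow> R x y)"

definition max_clique :: "('a \<Rightarrow> 'a \<Rightarrow> bool) \<Rightarrow> 'a set \<Rightarrow> nat" where
  "max_clique R L = Max (card ` {K. K \<subseteq> L \<and> is_clique R K})"

definition maximal_clique :: "('a \<Rightarrow> 'a \<Rightarrow> bool) \<Rightarrow> 'a set \<Rightarrow> 'a set \<Rightarrow> bool" where
  "maximal_clique R L K \<longleftrightarrow> K \<subseteq> L \<and> is_clique R K \<and> (\<forall>z\<in>L - K. \<exists>y\<in>K. \<not> R z y)"

text \<open>CIS: cliques intersect stable sets.\<close>

definition cis_on :: "('a \<Rightarrow> 'a \<Rightarrow> bool) \<Rightarrow> 'a set \<Rightarrow> bool" where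
  "cis_on R L \<longleftrightarrow> (L \<noteq> {} \<longrightarrow> (\<forall>K I. maximal_clique R L K \<longrightarrow>
     maximal_clique (\<lambda>x y. \<not> R x y) L I \<longrightarrow> K \<inter> I \<noteq> {}))"

lemma card_le_max_clique:
  "finite L \<Longrightarrow> K \<subseteq> L \<Longrightarrow> is_clique R K \<Longrightarrow> card K \<le> max_clique R L"
  unfolding max_clique_def by (intro Max_ge) auto

lemma max_clique_witness:
  assumes "finite L"
  obtains K where "K \<subseteq> L" "is_clique R K" "card K = max_clique R L"
proof -
  have "max_clique R L \<in> card ` {K. K \<subseteq> L \<and> is_clique R K}"
    unfolding max_clique_def using assms by (intro Max_in) (auto simp: is_clique_def)
  with that show thesis by auto
qed

lemma max_clique_eq_0_iff:
  assumes "finite L"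
  shows "max_clique R L = 0 \<longleftrightarrow> L = {}"
proof
  assume 0: "max_clique R L = 0"
  have "card {x} \<le> 0" if "x \<in> L" for x
    using card_le_max_clique[OF assms, of "{x}" R] that 0 by (simp add: is_clique_def)
  then show "L = {}" by auto
next
  assume "L = {}"
  then show "max_clique R L = 0"
    by (metis assms card.empty max_clique_witness subset_empty)
qed

lemma max_clique_mono:
  assumes "finite L" and "L' \<subseteq> L"
  shows "max_clique R L' \<le> max_clique R L"
proof -
  have "finite L'" using assms finite_subset by blast
  then obtain K where "K \<subseteq> L'" "is_clique R K" "card K = max_clique R L'"
    by (rule max_clique_witness)
  then show ?thesis using card_le_max_clique[of L K R] assms by auto
qed

text \<open>For the machine a vertex is only its position in the input order; this lemma,
  \<open>cis_image\<close> and \<open>card_core_image\<close> carry the graph notions over to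
  positions.\<close>

lemma max_clique_image:
  assumes "inj_on f L"
  shows "max_clique R (f ` L) = max_clique (\<lambda>i j. R (f i) (f j)) L"
proof -
  have 1: "is_clique R (f ` K) \<longleftrightarrow> is_clique (\<lambda>i j. R (f i) (f j)) K" if "K \<subseteq> L" for K
    using inj_on_subset[OF assms that] by (auto simp: is_clique_def inj_on_def)
  have "{K. K \<subseteq> f ` L \<and> is_clique R K} = image f ` {K. K \<subseteq> L \<and> is_clique (\<lambda>i j. R (f i) (f j)) K}"
  proof (intro set_eqI iffI)
    fix K assume "K \<in> {K. K \<subseteq> f ` L \<and> is_clique R K}"
    then show "K \<in> image f ` {K. K \<subseteq> L \<and> is_clique (\<lambda>i j. R (f i) (f j)) K}"
      by (auto simp: subset_image_iff 1)
  qed (auto simp: 1)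
  moreover have "card (f ` K) = card K" if "K \<subseteq> L" for K
    using that assms by (meson card_image inj_on_subset)
  ultimately show ?thesis
    unfolding max_clique_def by (simp add: image_image cong: image_cong_simp)
qed

section \<open>Co-graphs have the CIS property\<close>

lemma cis_complement: "cis_on (\<lambda>x y. \<not> R x y) L \<longleftrightarrow> cis_on R L"
  unfolding cis_on_def by (simp add: Int_commute) blast

lemma cis_cong:
  assumes "\<And>x y. x \<in> L \<Longrightarrow> y \<in> L \<Longrightarrow> R x y \<longleftrightarrow> R' x y"
  shows "cis_on R L \<longleftrightarrow> cis_on R' L"
proof -
  have "maximal_clique R L K \<longleftrightarrow> maximal_clique R' L K"
    "maximal_clique (\<lambda>x y. \<not> R x y) L K \<longleftrightarrow> maximal_clique (\<lambda>x y. \<not> R' x y) L K" for K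
    using assms unfolding maximal_clique_def is_clique_def by (smt (verit, ccfv_threshold) DiffD1 subsetD)+
  then show ?thesis by (simp add: cis_on_def)
qed

text \<open>No edge crosses, so a clique with a vertex in \<open>A\<close> lies in \<open>A\<close>.
  The trace of \<open>I\<close> on \<open>A\<close> is still maximal there, because the neighbour in
  \<open>I\<close> that excludes a vertex of \<open>A\<close> must itself lie in
  \<open>A\<close>.\<close>

lemma cis_union_aux:
  assumes cross: "\<And>x y. x \<in> A \<Longrightarrow> y \<in> B \<Longrightarrow> \<not> R x y \<and> \<not> R y x" and "A \<inter> B = {}"
    and "cis_on R A" and K: "maximal_clique R (A \<union> B) K" and x: "x \<in> K" "x \<in> A"
    and I: "maximal_clique (\<lambda>x y. \<not> R x y) (A \<union> B) I"
  shows "K \<inter> I \<noteq> {}"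
proof -
  have "y \<in> A" if "y \<in> K" for y
  proof (rule ccontr)
    assume "y \<notin> A"
    with that K have "y \<in> B" by (auto simp: maximal_clique_def)
    moreover have "R x y"
      using that K x \<open>y \<notin> A\<close> by (auto simp: maximal_clique_def is_clique_def)
    ultimately show False using cross x(2) by blast
  qed
  then have "maximal_clique R A K"
    using K unfolding maximal_clique_def by auto
  moreover have "maximal_clique (\<lambda>x y. \<not> R x y) A (I \<inter> A)"
    unfolding maximal_clique_def
  proof (intro conjI ballI)
    show "is_clique (\<lambda>x y. \<not> R x y) (I \<inter> A)"
      using I by (simp add: maximal_clique_def is_clique_def)
    fix z assume z: "z \<in> A - I \<inter> A"
    then obtain y where "y \<in> I" "R z y"
      using I by (auto simp: maximal_clique_def)
    moreover from this have "y \<in> A"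
      using I z cross[of z y] by (auto simp: maximal_clique_def)
    ultimately show "\<exists>y\<in>I \<inter> A. \<not> \<not> R z y" by blast
  qed simp
  ultimately have "K \<inter> (I \<inter> A) \<noteq> {}"
    using \<open>cis_on R A\<close> x(2) unfolding cis_on_def by blast
  then show ?thesis by blast
qed

lemma cis_union:
  assumes "\<And>x y. x \<in> A \<Longrightarrow> y \<in> B \<Longrightarrow> \<not> R x y \<and> \<not> R y x" and "A \<inter> B = {}"
    and "cis_on R A" and "cis_on R B"
  shows "cis_on R (A \<union> B)"
  unfolding cis_on_def
proof (intro impI allI)
  fix K I
  assume ne: "A \<union> B \<noteq> {}" and K: "maximal_clique R (A \<union> B) K"
    and I: "maximal_clique (\<lambda>x y. \<not> R x y) (A \<union> B) I"
  \<comment> \<open>The empty set is a maximal clique only of the empty set, the case that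
    \<open>cis_on\<close> exempts.\<close>
  from ne K obtain x where x: "x \<in> K" unfolding maximal_clique_def by blast
  then consider "x \<in> A" | "x \<in> B" using K unfolding maximal_clique_def by blast
  then show "K \<inter> I \<noteq> {}"
  proof cases
    case 1
    show ?thesis using cis_union_aux[OF assms(1-3) K x 1 I] .
  next
    case 2
    show ?thesis
      using cis_union_aux[of B A R K x I] assms K x 2 I by (simp add: Un_commute Int_commute)
  qed
qed

text \<open>A join is a union in the complement, and complementing merely exchanges the roles of
  \<open>K\<close> and \<open>I\<close>.\<close>

lemma cis_join:
  assumes "\<And>x y. x \<in> A \<Longrightarrow> y \<in> B \<Longrightarrow> R x y \<and> R y x" and "A \<inter> B = {}"
    and "cis_on R A" and "cis_on R B"
  shows "cis_on R (A \<union> B)"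
  using cis_union[of A B "\<lambda>x y. \<not> R x y"] assms by (simp add: cis_complement)

abbreviation adjacent :: "'a graph \<Rightarrow> 'a \<Rightarrow> 'a \<Rightarrow> bool" where
  "adjacent G x y \<equiv> {x, y} \<in> edges G"

lemma simple_graph_edge: "simple_graph G \<Longrightarrow> {x, y} \<in> edges G \<Longrightarrow> x \<in> verts G \<and> y \<in> verts G \<and> x \<noteq> y"
  by (auto simp: simple_graph_def nsets_def card_2_iff')

text \<open>Claiming this for all \<open>L\<close> makes the property hereditary, as the repeated
  removal of independent sets requires. \<open>L\<close> is split along the two vertex sets; either
  piece may be empty.\<close>

lemma cograph_cis: "cograph G \<Longrightarrow> L \<subseteq> verts G \<Longrightarrow> cis_on (adjacent G) L"
proof (induction arbitrary: L rule: cograph.induct)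
  case (single v)
  then show ?case by (auto simp: cis_on_def maximal_clique_def subset_singleton_iff)
next
  case (union G H)
  let ?A = "L \<inter> verts G" and ?B = "L \<inter> verts H"
  have disj: "x \<notin> verts H" if "x \<in> verts G" for x using union.hyps(3) that by blast
  note sg = simple_graph_edge[OF cograph_simple_graph[OF union.hyps(1)]]
  note sh = simple_graph_edge[OF cograph_simple_graph[OF union.hyps(2)]]
  have "cis_on (adjacent (graph_union G H)) (?A \<union> ?B)"
  proof (rule cis_union)
    show "cis_on (adjacent (graph_union G H)) ?A"
      using union.IH(1)[of ?A] disj
      by (subst cis_cong[where R' = "adjacent G"]) (auto simp: graph_union_def dest: sh)
    show "cis_on (adjacent (graph_union G H)) ?B"
      using union.IH(2)[of ?B] disj
      by (subst cis_cong[where R' = "adjacent H"]) (auto simp: graph_union_def dest: sg)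
  qed (use disj in \<open>auto simp: graph_union_def dest: sg sh\<close>)
  moreover have "?A \<union> ?B = L" using union.prems by (auto simp: graph_union_def)
  ultimately show ?case by simp
next
  case (join G H)
  let ?A = "L \<inter> verts G" and ?B = "L \<inter> verts H"
  have disj: "x \<notin> verts H" if "x \<in> verts G" for x using join.hyps(3) that by blast
  note sg = simple_graph_edge[OF cograph_simple_graph[OF join.hyps(1)]]
  note sh = simple_graph_edge[OF cograph_simple_graph[OF join.hyps(2)]]
  have "cis_on (adjacent (graph_join G H)) (?A \<union> ?B)"
  proof (rule cis_join)
    show "cis_on (adjacent (graph_join G H)) ?A"
      using join.IH(1)[of ?A] disj
      by (subst cis_cong[where R' = "adjacent G"]) (auto simp: graph_join_def doubleton_eq_iff dest: sh)
    show "cis_on (adjacent (graph_join G H)) ?B"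
      using join.IH(2)[of ?B] disj
      by (subst cis_cong[where R' = "adjacent H"]) (auto simp: graph_join_def doubleton_eq_iff dest: sg)
  qed (use join.hyps(3) in \<open>auto simp: graph_join_def doubleton_eq_iff\<close>)
  moreover have "?A \<union> ?B = L" using join.prems by (auto simp: graph_join_def)
  ultimately show ?case by simp
qed

lemma cis_image:
  assumes "inj_on f L" and "cis_on R (f ` L)"
  shows "cis_on (\<lambda>i j. R (f i) (f j)) L"
  unfolding cis_on_def
proof (intro impI allI)
  have maximal: "maximal_clique Q (f ` L) (f ` K)" if "maximal_clique (\<lambda>i j. Q (f i) (f j)) L K" for Q K
    using that unfolding maximal_clique_def is_clique_def by (auto 4 3)
  fix K I
  assume "L \<noteq> {}" and K: "maximal_clique (\<lambda>i j. R (f i) (f j)) L K"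
    and I: "maximal_clique (\<lambda>i j. \<not> R (f i) (f j)) L I"
  with maximal[OF K] maximal[OF I] assms(2) have "f ` K \<inter> f ` I \<noteq> {}"
    unfolding cis_on_def by blast
  moreover have "f ` K \<inter> f ` I = f ` (K \<inter> I)"
    using assms(1) K I by (auto simp: maximal_clique_def inj_on_def) blast
  ultimately show "K \<inter> I \<noteq> {}" by auto
qed

text \<open>A clique avoiding \<open>I\<close> cannot be maximum in \<open>L\<close>, since it would
  then be maximal and meet \<open>I\<close>. Conversely, an independent set takes at most one vertex
  away from a maximum clique.\<close>

lemma max_clique_diff_independent:
  assumes fin: "finite L" and "L \<noteq> {}" and sym: "\<And>x y. R x y \<Longrightarrow> R y x" and "cis_on R L"
    and I: "maximal_clique (\<lambda>x y. \<not> R x y) L I"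
  shows "Suc (max_clique R (L - I)) = max_clique R L"
proof (rule antisym)
  obtain K where K: "K \<subseteq> L - I" "is_clique R K" "card K = max_clique R (L - I)"
    using max_clique_witness[of "L - I"] fin by auto
  then have finK: "finite K" using fin by (meson finite_Diff finite_subset)
  have "card K \<noteq> max_clique R L"
  proof
    assume max: "card K = max_clique R L"
    have "\<exists>y\<in>K. \<not> R z y" if "z \<in> L - K" for z
    proof (rule ccontr)
      assume "\<not> ?thesis"
      with K sym have "is_clique R (insert z K)" unfolding is_clique_def by blast
      then have "card (insert z K) \<le> max_clique R L"
        using that K fin by (intro card_le_max_clique) auto
      with that finK max show False by simp
    qed
    with K have "maximal_clique R L K" by (auto simp: maximal_clique_def)
    with assms have "K \<inter> I \<noteq> {}" unfolding cis_on_def by blast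
    with K show False by blast
  qed
  moreover have "card K \<le> max_clique R L"
    using K fin by (intro card_le_max_clique) auto
  ultimately show "Suc (max_clique R (L - I)) \<le> max_clique R L" using K by simp
next
  obtain K where K: "K \<subseteq> L" "is_clique R K" "card K = max_clique R L"
    using max_clique_witness[OF fin] by metis
  have "card (K \<inter> I) \<le> 1"
    using K I finite_subset[OF K(1) fin] unfolding maximal_clique_def is_clique_def
    by (auto simp: card_le_Suc0_iff_eq) blast
  moreover have "card K = card (K \<inter> I) + card (K - I)"
    using finite_subset[OF K(1) fin] by (rule card_Int_Diff)
  moreover have "card (K - I) \<le> max_clique R (L - I)"
    using K fin by (intro card_le_max_clique) (auto simp: is_clique_def)
  ultimately show "max_clique R L \<le> Suc (max_clique R (L - I))" using K by simp
qed

section \<open>Stability and vertices common to all maximum cliques\<close>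

lemma clique_number_eq: "\<omega> G = max_clique (adjacent G) (verts G)"
  unfolding clique_number_def max_clique_def is_clique_def clique_def
  by (simp only: setcompr_eq_image)

text \<open>These are the vertices common to all maximum cliques, see \<open>core_iff\<close>; the
  definition compares two clique numbers because that is what the machine can do.\<close>

definition core :: "('a \<Rightarrow> 'a \<Rightarrow> bool) \<Rightarrow> 'a set \<Rightarrow> 'a set" where
  "core R V = {v\<in>V. max_clique R (V - {v}) < max_clique R V}"

lemma core_iff:
  assumes "finite V" and "v \<in> V"
  shows "v \<in> core R V \<longleftrightarrow> (\<forall>K\<subseteq>V. is_clique R K \<longrightarrow> card K = max_clique R V \<longrightarrow> v \<in> K)"
proof
  assume v: "v \<in> core R V"
  show "\<forall>K\<subseteq>V. is_clique R K \<longrightarrow> card K = max_clique R V \<longrightarrow> v \<in> K"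
  proof (intro allI impI, rule ccontr)
    fix K assume "K \<subseteq> V" "is_clique R K" "card K = max_clique R V" "v \<notin> K"
    with assms card_le_max_clique[of "V - {v}" K R] v show False by (auto simp: core_def)
  qed
next
  assume *: "\<forall>K\<subseteq>V. is_clique R K \<longrightarrow> card K = max_clique R V \<longrightarrow> v \<in> K"
  obtain K where K: "K \<subseteq> V - {v}" "is_clique R K" "card K = max_clique R (V - {v})"
    using max_clique_witness[of "V - {v}"] assms by auto
  with * have "max_clique R (V - {v}) \<noteq> max_clique R V" by auto
  moreover have "max_clique R (V - {v}) \<le> max_clique R V"
    using assms by (intro max_clique_mono) auto
  ultimately show "v \<in> core R V" using assms by (simp add: core_def)
qed

text \<open>The cliques that survive the deletion are those not containing both ends. So the clique
  number drops iff every maximum clique contains both.\<close>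

lemma clique_number_delete_edge:
  assumes "simple_graph G" and "u \<noteq> v" and e: "{u, v} \<in> edges G"
  shows "\<omega> (delete_edge G {u, v}) = \<omega> G \<longleftrightarrow> \<not> {u, v} \<subseteq> core (adjacent G) (verts G)"
proof -
  let ?V = "verts G" and ?k = "\<omega> G" and ?D = "delete_edge G {u, v}"
  have fin: "finite ?V" and uv: "u \<in> ?V" "v \<in> ?V"
    using assms simple_graph_edge[OF assms(1) e] by (auto simp: simple_graph_def)
  have V: "verts ?D = ?V" by (simp add: delete_edge_def)
  have clique_D: "is_clique (adjacent ?D) K \<longleftrightarrow> is_clique (adjacent G) K \<and> \<not> {u, v} \<subseteq> K" for K
    using \<open>u \<noteq> v\<close> by (auto simp: is_clique_def delete_edge_def doubleton_eq_iff)
  have le: "\<omega> ?D \<le> ?k"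
  proof -
    obtain K where "K \<subseteq> ?V" "is_clique (adjacent ?D) K" "card K = \<omega> ?D"
      using max_clique_witness[OF fin] unfolding clique_number_eq V by metis
    then show ?thesis
      using card_le_max_clique[OF fin, of K "adjacent G"] clique_D by (simp add: clique_number_eq)
  qed
  have "\<omega> ?D = ?k \<longleftrightarrow> (\<exists>K\<subseteq>?V. is_clique (adjacent G) K \<and> \<not> {u, v} \<subseteq> K \<and> card K = ?k)"
  proof
    assume "\<omega> ?D = ?k"
    then show "\<exists>K\<subseteq>?V. is_clique (adjacent G) K \<and> \<not> {u, v} \<subseteq> K \<and> card K = ?k"
      using max_clique_witness[OF fin, of "adjacent ?D"] clique_D unfolding clique_number_eq V by metis
  next
    assume "\<exists>K\<subseteq>?V. is_clique (adjacent G) K \<and> \<not> {u, v} \<subseteq> K \<and> card K = ?k"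
    then obtain K where "K \<subseteq> ?V" "is_clique (adjacent ?D) K" "card K = ?k"
      using clique_D by auto
    with card_le_max_clique[OF fin, of K "adjacent ?D"] le show "\<omega> ?D = ?k"
      by (simp add: clique_number_eq V)
  qed
  also have "\<dots> \<longleftrightarrow> \<not> {u, v} \<subseteq> core (adjacent G) ?V"
    using core_iff[OF fin uv(1), of "adjacent G"] core_iff[OF fin uv(2), of "adjacent G"]
    by (auto simp: clique_number_eq)
  finally show ?thesis .
qed

lemma omega_stability_iff:
  assumes "simple_graph G"
  shows "G \<in> omega_stability \<longleftrightarrow> card (core (adjacent G) (verts G)) \<le> 1"
proof -
  let ?V = "verts G" and ?C = "core (adjacent G) (verts G)"
  have fin: "finite ?V" using assms by (simp add: simple_graph_def)
  then have finC: "finite ?C" by (simp add: core_def)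
  \<comment> \<open>Any single maximum clique contains the whole core.\<close>
  have pair: "{u, v} \<in> edges G" if "u \<in> ?C" "v \<in> ?C" "u \<noteq> v" for u v
  proof -
    obtain K where "K \<subseteq> ?V" "is_clique (adjacent G) K" "card K = max_clique (adjacent G) ?V"
      using max_clique_witness[OF fin] by metis
    moreover from this have "u \<in> K" "v \<in> K"
      using core_iff[OF fin, of _ "adjacent G"] that by (auto simp: core_def)
    ultimately show ?thesis using that by (simp add: is_clique_def)
  qed
  have "G \<in> omega_stability \<longleftrightarrow> (\<forall>u v. {u, v} \<in> edges G \<longrightarrow> \<not> {u, v} \<subseteq> ?C)"
  proof -
    have "\<exists>u v. e = {u, v}" if "e \<in> edges G" for e
      using that assms by (auto simp: simple_graph_def nsets_def card_2_iff) blast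
    then have "(\<forall>e\<in>edges G. \<omega> (delete_edge G e) = \<omega> G) \<longleftrightarrow>
        (\<forall>u v. {u, v} \<in> edges G \<longrightarrow> \<omega> (delete_edge G {u, v}) = \<omega> G)"
      by metis
    also have "\<dots> \<longleftrightarrow> (\<forall>u v. {u, v} \<in> edges G \<longrightarrow> \<not> {u, v} \<subseteq> ?C)"
      using clique_number_delete_edge[OF assms] simple_graph_edge[OF assms] by metis
    finally show ?thesis using assms by (simp add: omega_stability_def)
  qed
  also have "\<dots> \<longleftrightarrow> (\<forall>u\<in>?C. \<forall>v\<in>?C. u = v)"
    using pair simple_graph_edge[OF assms] by (metis insert_subset empty_subsetI)
  also have "\<dots> \<longleftrightarrow> card ?C \<le> 1"
    using finC by (auto simp: card_le_Suc0_iff_eq)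
  finally show ?thesis .
qed

lemma card_core_image:
  assumes "inj_on f V"
  shows "card (core R (f ` V)) = card (core (\<lambda>i j. R (f i) (f j)) V)"
proof -
  have "max_clique R (f ` V - {f v}) = max_clique (\<lambda>i j. R (f i) (f j)) (V - {v})" if "v \<in> V" for v
  proof -
    have "f ` V - {f v} = f ` (V - {v})" using assms that by (auto simp: inj_on_def)
    then show ?thesis using max_clique_image[of f "V - {v}" R] assms by (simp add: inj_on_diff)
  qed
  then have "core R (f ` V) = f ` core (\<lambda>i j. R (f i) (f j)) V"
    using max_clique_image[OF assms, of R] by (auto simp: core_def)
  moreover have "inj_on f (core (\<lambda>i j. R (f i) (f j)) V)"
    using assms by (auto simp: core_def inj_on_def)
  ultimately show ?thesis by (simp add: card_image)
qed

section \<open>The greedy maximal independent set\<close>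

primrec greedy :: "(nat \<Rightarrow> nat \<Rightarrow> bool) \<Rightarrow> nat set \<Rightarrow> nat \<Rightarrow> nat set" where
  "greedy E L 0 = {}"
| "greedy E L (Suc u) =
     (if u \<in> L \<and> (\<forall>w\<in>greedy E L u. \<not> E u w) then insert u (greedy E L u) else greedy E L u)"

lemma greedy_subset: "greedy E L u \<subseteq> L \<inter> {..<u}"
  by (induction u) (auto simp: less_Suc_eq)

text \<open>Stated for every initial segment to carry the induction: a refused vertex has a chosen
  neighbour, which stays chosen. Symmetry enters because \<open>greedy\<close> tests
  \<open>E u w\<close> only from the later vertex \<open>u\<close>.\<close>

lemma maximal_clique_greedy:
  assumes sym: "\<And>x y. E x y \<Longrightarrow> E y x"
  shows "maximal_clique (\<lambda>x y. \<not> E x y) (L \<inter> {..<u}) (greedy E L u)"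
proof (induction u)
  case (Suc u)
  have "L \<inter> {..<Suc u} = (if u \<in> L then insert u (L \<inter> {..<u}) else L \<inter> {..<u})"
    by (auto simp: less_Suc_eq)
  with Suc sym show ?case
    unfolding maximal_clique_def is_clique_def by auto
qed (simp add: maximal_clique_def is_clique_def)

lemma max_clique_diff_greedy:
  assumes "\<And>x y. E x y \<Longrightarrow> E y x" and "L \<subseteq> {..<n}" and "L \<noteq> {}" and "cis_on E L"
  shows "Suc (max_clique E (L - greedy E L n)) = max_clique E L"
proof (rule max_clique_diff_independent)
  show "finite L" using assms(2) finite_subset by blast
  show "maximal_clique (\<lambda>x y. \<not> E x y) L (greedy E L n)"
    using maximal_clique_greedy[of E L n, OF assms(1)] assms(2) by (simp add: Int_absorb2)
qed (use assms in auto)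

section \<open>Tape contents and elementary programs\<close>

text \<open>Integer positions let a sweep to the left run onto the blank cell -1 and stop there.
  \<open>tp [] 0\<close> and \<open>tp [0] 0\<close> are the same tape; the form
  \<open>tp [r] 0\<close> is used for one-cell registers.\<close>

definition tp :: "nat list \<Rightarrow> int \<Rightarrow> tape" where
  "tp xs p = (p, \<lambda>i. if 0 \<le> i \<and> i < int (length xs) then xs ! nat i else 0)"

lemma scanned_tp: "scanned (tp xs (int i)) = (if i < length xs then xs ! i else 0)"
  by (simp add: tp_def)

lemma scanned_tp_minus_1 [simp]: "scanned (tp xs (- 1)) = 0"
  by (simp add: tp_def)

lemma scanned_tp_single [simp]: "scanned (tp [r] 0) = r"
  by (simp add: tp_def)

lemma act_scanned_tp [simp]: "act (scanned (tp xs p), d) (tp xs p) = tp xs (shift d p)"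
  by (auto simp: tp_def)

lemma act_tp_minus_1 [simp]: "act (0, d) (tp xs (- 1)) = tp xs (shift d (- 1))"
  using act_scanned_tp[of xs "- 1" d] by simp

text \<open>The boundary case \<open>i = length xs\<close> appends a symbol.\<close>

lemma act_tp_write:
  assumes "i \<le> length xs"
  shows "act (s, d) (tp xs (int i)) = tp (take i xs @ s # drop (Suc i) xs) (shift d (int i))"
proof -
  have "(\<lambda>j. if 0 \<le> j \<and> j < int (length xs) then xs ! nat j else 0)(int i := s) =
      (\<lambda>j. if 0 \<le> j \<and> j < int (length (take i xs @ s # drop (Suc i) xs))
           then (take i xs @ s # drop (Suc i) xs) ! nat j else 0)"
  proof
    fix j
    consider "j < 0" | k where "j = int k" by (metis int_nat_eq not_le)
    then show "((\<lambda>j. if 0 \<le> j \<and> j < int (length xs) then xs ! nat j else 0)(int i := s)) j =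
      (if 0 \<le> j \<and> j < int (length (take i xs @ s # drop (Suc i) xs))
           then (take i xs @ s # drop (Suc i) xs) ! nat j else 0)"
      using assms by cases (auto simp: nth_append nth_Cons' min_def)
  qed
  then show ?thesis by (simp add: tp_def)
qed

lemma act_tp: "i < length xs \<Longrightarrow> act (s, d) (tp xs (int i)) = tp (xs[i := s]) (shift d (int i))"
  by (simp add: act_tp_write upd_conv_take_nth_drop)

lemma act_tp_single [simp]: "act (s, St) (tp [r] 0) = tp [s] 0"
  using act_tp[of 0 "[r]" s St] by simp

lemma length_stay: "length (stay syms) = length syms"
  by (simp add: stay_def)

section \<open>Simultaneous updates of several tapes\<close>

definition acts :: "(nat \<times> (nat list \<Rightarrow> nat \<times> move)) list \<Rightarrow> nat list \<Rightarrow> (nat \<times> move) list" where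
  "acts us syms = fold (\<lambda>(i, a) xs. xs[i := a syms]) us (stay syms)"

definition mv :: "move \<Rightarrow> nat \<Rightarrow> nat \<times> (nat list \<Rightarrow> nat \<times> move)" where
  "mv d i = (i, \<lambda>syms. (syms ! i, d))"

definition wr :: "nat \<Rightarrow> nat \<Rightarrow> move \<Rightarrow> nat \<times> (nat list \<Rightarrow> nat \<times> move)" where
  "wr i s d = (i, \<lambda>syms. (s, d))"

text \<open>On the right each update acts on the old tape \<open>ts ! i\<close> and sees the old
  symbols: the list describes one machine step, not a sequence of steps.\<close>

lemma map2_act_fold:
  "length xs = length ts \<Longrightarrow>
   map2 act (fold (\<lambda>(i, a) xs. xs[i := a syms]) us xs) ts =
   fold (\<lambda>(i, a) ts'. ts'[i := act (a syms) (ts ! i)]) us (map2 act xs ts)"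
proof (induction us arbitrary: xs)
  case (Cons u us)
  obtain i a where u: "u = (i, a)" by fastforce
  have "map2 act (xs[i := a syms]) ts = (map2 act xs ts)[i := act (a syms) (ts ! i)]"
    using Cons.prems
    by (cases "i < length ts") (simp_all add: list_eq_iff_nth_eq nth_list_update)
  with Cons show ?case by (simp add: u)
qed simp

lemma runs_acts:
  "ts' = fold (\<lambda>(i, a) ts'. ts'[i := act (a (map scanned ts)) (ts ! i)]) us ts \<Longrightarrow>
   runs (Do (acts us)) ts 1 ts'"
  unfolding acts_def by (rule runs_Do) (simp add: map2_act_fold length_stay)

lemma wf_acts_acts:
  assumes "\<forall>(i, a)\<in>set us. \<forall>syms. length syms = k \<longrightarrow> (\<forall>i<k. syms ! i < m) \<longrightarrow> fst (a syms) < m"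
  shows "wf_acts k m (acts us)"
proof -
  have *: "length (fold (\<lambda>(i, a) xs. xs[i := a syms]) us xs) = k \<and>
      (\<forall>(s, d)\<in>set (fold (\<lambda>(i, a) xs. xs[i := a syms]) us xs). s < m)"
    if "length syms = k" "\<forall>s\<in>set syms. s < m" "length xs = k" "\<forall>(s, d)\<in>set xs. s < m" for syms xs
    using that assms
  proof (induction us arbitrary: xs)
    case (Cons u us)
    obtain i a where u: "u = (i, a)" by fastforce
    have "fst (a syms) < m" using Cons.prems u by (simp add: all_set_conv_all_nth)
    then have "\<forall>(s, d)\<in>set (xs[i := a syms]). s < m"
      using Cons.prems(4) set_update_subset_insert[of xs i "a syms"] by (auto simp: split_beta)
    then show ?case using Cons.IH[of "xs[i := a syms]"] Cons.prems by (simp add: u)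
  qed auto
  show ?thesis
    unfolding wf_acts_def acts_def
  proof (intro allI impI, elim conjE)
    fix syms :: "nat list"
    assume "length syms = k" "\<forall>s\<in>set syms. s < m"
    then show "length (fold (\<lambda>(i, a) xs. xs[i := a syms]) us (stay syms)) = k \<and>
        (\<forall>(s, d)\<in>set (fold (\<lambda>(i, a) xs. xs[i := a syms]) us (stay syms)). s < m)"
      by (intro *) (auto simp: stay_def)
  qed
qed

text \<open>The first step to the left lets the head start on the blank behind the word; the loop
  then runs to the blank cell -1.\<close>

definition rewind :: "nat \<Rightarrow> com" where
  "rewind i = Do (acts [mv Lt i]) ;; While (\<lambda>s. s ! i \<noteq> 0) (Do (acts [mv Lt i])) ;; Do (acts [mv Rt i])"

lemma runs_rewind:
  assumes "ts ! i = tp xs (int p)" and "i < length ts" and "p \<le> length xs" and "0 \<notin> set xs"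
  shows "runs (rewind i) ts (3 * p + 5) (ts[i := tp xs 0])"
proof -
  define \<sigma> where "\<sigma> j = ts[i := tp xs (int p - 1 - int j)]" for j
  have *: "scanned (tp xs (int p - 1 - int j)) = xs ! (p - 1 - j)" "p - 1 - j < length xs" if "j < p" for j
  proof -
    have "int p - 1 - int j = int (p - 1 - j)" using that by simp
    then show "scanned (tp xs (int p - 1 - int j)) = xs ! (p - 1 - j)" "p - 1 - j < length xs"
      using that assms(3) by (simp_all only: scanned_tp) auto
  qed
  have 1: "runs (Do (acts [mv Lt i])) ts 1 (\<sigma> 0)"
    using assms by (intro runs_acts) (simp add: mv_def \<sigma>_def)
  have "runs (While (\<lambda>s. s ! i \<noteq> 0) (Do (acts [mv Lt i]))) (\<sigma> 0) (p * (1 + 2) + 1) (\<sigma> p)"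
  proof (rule runs_While)
    fix j assume "j < p"
    then have "xs ! (p - 1 - j) \<noteq> 0" using *(2) assms(4) by (metis nth_mem)
    then show "map scanned (\<sigma> j) ! i \<noteq> 0" using assms(2) * \<open>j < p\<close> by (simp add: \<sigma>_def)
    show "runs (Do (acts [mv Lt i])) (\<sigma> j) 1 (\<sigma> (Suc j))"
      using assms(2) by (intro runs_acts) (simp add: mv_def \<sigma>_def algebra_simps)
  qed (use assms(2) in \<open>simp add: \<sigma>_def\<close>)
  moreover have "runs (Do (acts [mv Rt i])) (\<sigma> p) 1 (ts[i := tp xs 0])"
    using assms(2) by (intro runs_acts) (simp add: mv_def \<sigma>_def)
  ultimately show ?thesis
    unfolding rewind_def using 1 by (intro runs_mono[OF runs_Seq[OF _ runs_Seq]]) auto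
qed

lemma runs_rewind_le:
  assumes "ts ! i = tp xs (int p)" and "i < length ts" and "p \<le> length xs" and "0 \<notin> set xs"
    and "p \<le> n" and "ts' = ts[i := tp xs 0]"
  shows "runs (rewind i) ts (3 * n + 5) ts'"
  using runs_mono[OF runs_rewind[OF assms(1-4)]] assms(5,6) by simp

section \<open>Computing the number of vertices\<close>

text \<open>Tape 0 is the input and tape 1 a unary counter. When the counter is \<open>k\<close>, the input head is at
  \<open>k\<^sup>2\<close> and moves on by \<open>1 + k + k\<close> cells, during one sweep over the counter in each direction.\<close>

definition count_com :: com where
  "count_com = While (\<lambda>s. s ! 0 \<noteq> 0)
     (Do (acts [mv Rt 0]) ;; While (\<lambda>s. s ! 1 \<noteq> 0) (Do (acts [mv Rt 0, mv Rt 1])) ;;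
      Do (acts [wr 1 1 Lt]) ;; While (\<lambda>s. s ! 1 \<noteq> 0) (Do (acts [mv Rt 0, mv Lt 1])) ;;
      Do (acts [mv Rt 1]))"

text \<open>The input head visits exactly the squares at the loop test, and among them
  \<open>n * n\<close> is the first blank cell.\<close>

lemma runs_count_com:
  assumes "length xs = n * n" and "0 \<notin> set xs"
  shows "runs count_com [tp xs 0, tp [] 0, t2, t3, t4, t5] (n * (6 * n + 11) + 1)
    [tp xs (int (n * n)), tp (replicate n 1) 0, t2, t3, t4, t5]"
proof -
  define \<sigma> where "\<sigma> k = [tp xs (int (k * k)), tp (replicate k 1) 0, t2, t3, t4, t5]" for k
  let ?right = "While (\<lambda>s. s ! 1 \<noteq> 0) (Do (acts [mv Rt 0, mv Rt 1]))"
  let ?left = "While (\<lambda>s. s ! 1 \<noteq> 0) (Do (acts [mv Rt 0, mv Lt 1]))"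
  have "runs count_com (\<sigma> 0) (n * ((6 * n + 9) + 2) + 1) (\<sigma> n)"
    unfolding count_com_def
  proof (rule runs_While)
    fix k assume k: "k < n"
    then have "k * k < n * n" by (intro mult_strict_mono) auto
    then have "xs ! (k * k) \<noteq> 0" using assms by (metis nth_mem)
    with \<open>k * k < n * n\<close> show "map scanned (\<sigma> k) ! 0 \<noteq> 0"
      using assms(1) by (simp add: \<sigma>_def scanned_tp del: of_nat_mult)
    define \<rho> where "\<rho> j = [tp xs (int (k * k + 1 + j)), tp (replicate k 1) (int j), t2, t3, t4, t5]" for j
    \<comment> \<open>Appending the new cell \<open>k\<close> also moves the counter head to
      \<open>k - 1\<close>, so the way back crosses only the \<open>k\<close> old cells.\<close>
    define \<tau> where
      "\<tau> j = [tp xs (int (k * k + 1 + k + j)), tp (replicate (Suc k) 1) (int k - 1 - int j), t2, t3, t4, t5]" for j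
    have 1: "runs (Do (acts [mv Rt 0])) (\<sigma> k) 1 (\<rho> 0)"
      by (intro runs_acts) (simp add: mv_def \<sigma>_def \<rho>_def add.commute)
    have 2: "runs ?right (\<rho> 0) (k * (1 + 2) + 1) (\<rho> k)"
    proof (rule runs_While)
      fix j assume "j < k"
      then show "map scanned (\<rho> j) ! 1 \<noteq> 0" by (simp add: \<rho>_def scanned_tp)
      show "runs (Do (acts [mv Rt 0, mv Rt 1])) (\<rho> j) 1 (\<rho> (Suc j))"
        by (intro runs_acts) (simp add: mv_def \<rho>_def algebra_simps)
    qed (simp add: \<rho>_def scanned_tp)
    have 3: "runs (Do (acts [wr 1 1 Lt])) (\<rho> k) 1 (\<tau> 0)"
      by (intro runs_acts)
        (simp add: wr_def \<rho>_def \<tau>_def act_tp_write replicate_append_same flip: replicate_Suc)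
    have 4: "runs ?left (\<tau> 0) (k * (1 + 2) + 1) (\<tau> k)"
    proof (rule runs_While)
      fix j assume "j < k"
      then have "int k - 1 - int j = int (k - 1 - j)" by simp
      then show "map scanned (\<tau> j) ! 1 \<noteq> 0"
        by (simp add: \<tau>_def scanned_tp del: of_nat_diff replicate_Suc)
      show "runs (Do (acts [mv Rt 0, mv Lt 1])) (\<tau> j) 1 (\<tau> (Suc j))"
        by (intro runs_acts) (simp add: mv_def \<tau>_def algebra_simps)
    qed (simp add: \<tau>_def)
    have 5: "runs (Do (acts [mv Rt 1])) (\<tau> k) 1 (\<sigma> (Suc k))"
      by (intro runs_acts) (simp add: mv_def \<tau>_def \<sigma>_def algebra_simps)
    show "runs (Do (acts [mv Rt 0]) ;; ?right ;; Do (acts [wr 1 1 Lt]) ;; ?left ;; Do (acts [mv Rt 1]))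
        (\<sigma> k) (6 * n + 9) (\<sigma> (Suc k))"
      using k
      by (intro runs_mono[OF runs_Seq[OF 1 runs_Seq[OF 2 runs_Seq[OF 3 runs_Seq[OF 4 5]]]]]) simp
  qed (use assms(1) in \<open>simp add: \<sigma>_def scanned_tp del: of_nat_mult\<close>)
  then show ?thesis by (simp add: \<sigma>_def add.commute)
qed

section \<open>One round of the greedy algorithm\<close>

definition adj_list :: "(nat \<Rightarrow> nat \<Rightarrow> bool) \<Rightarrow> nat \<Rightarrow> nat list" where
  "adj_list E n = map (\<lambda>i. if E (i div n) (i mod n) then 2 else 1) [0..<n * n]"

lemma length_adj_list [simp]: "length (adj_list E n) = n * n"
  by (simp add: adj_list_def)

lemma zero_notin_adj_list: "0 \<notin> set (adj_list E n)"
  by (auto simp: adj_list_def)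

lemma nth_adj_list:
  assumes "u < n" and "w < n"
  shows "u * n + w < n * n" and "adj_list E n ! (u * n + w) = (if E u w then 2 else 1)"
proof -
  have "u * n + w < Suc u * n" using assms by simp
  also have "\<dots> \<le> n * n" using assms by (intro mult_le_mono1) simp
  finally show *: "u * n + w < n * n" .
  then show "adj_list E n ! (u * n + w) = (if E u w then 2 else 1)"
    using assms by (simp add: adj_list_def)
qed

text \<open>Cells of the work tape: 1 and 2 stand for vertices that this round has not reached yet and
  that are still present (1) or already removed (2); the vertices it has passed are marked 4 if they
  were put into the independent set, 3 if they were present but not chosen, and 5 if they had been
  removed before.\<close>

definition cell :: "nat set \<Rightarrow> nat set \<Rightarrow> nat \<Rightarrow> nat \<Rightarrow> nat" where
  "cell L I u w = (if w < u then if w \<in> I then 4 else if w \<in> L then 3 else 5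
     else if w \<in> L then 1 else 2)"

definition cells :: "nat \<Rightarrow> nat set \<Rightarrow> nat set \<Rightarrow> nat \<Rightarrow> nat list" where
  "cells n L I u = map (cell L I u) [0..<n]"

lemma length_cells [simp]: "length (cells n L I u) = n"
  by (simp add: cells_def)

lemma nth_cells [simp]: "w < n \<Longrightarrow> cells n L I u ! w = cell L I u w"
  by (simp add: cells_def)

lemma cell_pos [simp]: "0 < cell L I u w"
  by (simp add: cell_def)

lemma zero_notin_cells: "0 \<notin> set (cells n L I u)"
  by (auto simp: cells_def cell_def)

text \<open>After a round only the vertices marked 3 survive. The marks 1 and 2 are fixed, so the
  same sweep can be run on a fresh work tape, where it just records whether any vertex is
  present.\<close>

definition norm_cell :: "nat \<Rightarrow> nat" where
  "norm_cell s = (if s = 1 \<or> s = 3 then 1 else 2)"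

definition norm_com :: com where
  "norm_com = Do (acts [wr 4 0 St]) ;;
     While (\<lambda>s. s ! 2 \<noteq> 0)
       (Do (acts [(2, \<lambda>s. (norm_cell (s ! 2), Rt)),
                  (4, \<lambda>s. (if s ! 2 = 1 \<or> s ! 2 = 3 then 1 else s ! 4, St))])) ;;
     rewind 2"

lemma runs_norm_com:
  assumes "length ss = n" and "0 \<notin> set ss"
  shows "runs norm_com [t0, t1, tp ss 0, t3, tp [r] 0, t5] (6 * n + 9)
    [t0, t1, tp (map norm_cell ss) 0, t3, tp [if 1 \<in> set ss \<or> 3 \<in> set ss then 1 else 0] 0, t5]"
proof -
  define \<sigma> where "\<sigma> i = [t0, t1, tp (map norm_cell (take i ss) @ drop i ss) (int i), t3,
    tp [if 1 \<in> set (take i ss) \<or> 3 \<in> set (take i ss) then 1 else 0] 0, t5]" for i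
  have 1: "runs (Do (acts [wr 4 0 St])) [t0, t1, tp ss 0, t3, tp [r] 0, t5] 1 (\<sigma> 0)"
    by (intro runs_acts) (simp add: wr_def \<sigma>_def)
  have 2: "runs (While (\<lambda>s. s ! 2 \<noteq> 0)
       (Do (acts [(2, \<lambda>s. (norm_cell (s ! 2), Rt)),
                  (4, \<lambda>s. (if s ! 2 = 1 \<or> s ! 2 = 3 then 1 else s ! 4, St))])))
       (\<sigma> 0) (n * (1 + 2) + 1) (\<sigma> n)"
  proof (rule runs_While)
    fix i assume i: "i < n"
    then have nth: "(map norm_cell (take i ss) @ drop i ss) ! i = ss ! i"
      using assms(1) by (simp add: nth_append)
    have "ss ! i \<noteq> 0" using i assms nth_mem by metis
    with nth i assms(1) show "map scanned (\<sigma> i) ! 2 \<noteq> 0"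
      by (simp add: \<sigma>_def scanned_tp)
    have upd: "(map norm_cell (take i ss) @ drop i ss)[i := x] =
        map norm_cell (take i ss) @ x # drop (Suc i) ss" for x
      using i assms(1) by (simp add: list_update_append Cons_nth_drop_Suc[symmetric])
    show "runs (Do (acts [(2, \<lambda>s. (norm_cell (s ! 2), Rt)),
        (4, \<lambda>s. (if s ! 2 = 1 \<or> s ! 2 = 3 then 1 else s ! 4, St))])) (\<sigma> i) 1 (\<sigma> (Suc i))"
      using i assms(1) nth
      by (intro runs_acts)
        (auto simp: \<sigma>_def scanned_tp act_tp upd take_Suc_conv_app_nth add.commute)
  qed (use assms(1) in \<open>simp add: \<sigma>_def scanned_tp\<close>)
  have 3: "runs (rewind 2) (\<sigma> n) (3 * n + 5)
    [t0, t1, tp (map norm_cell ss) 0, t3, tp [if 1 \<in> set ss \<or> 3 \<in> set ss then 1 else 0] 0, t5]"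
    using assms by (intro runs_rewind_le[of _ _ "map norm_cell ss" n]) (auto simp: \<sigma>_def norm_cell_def)
  show ?thesis
    unfolding norm_com_def by (rule runs_mono[OF runs_Seq[OF 1 runs_Seq[OF 2 3]]]) simp
qed

lemma norm_cells:
  assumes "L \<subseteq> {..<n}"
  shows "map norm_cell (cells n L I n) = cells n (L - I) {} 0"
    and "1 \<in> set (cells n L I n) \<or> 3 \<in> set (cells n L I n) \<longleftrightarrow> L - I \<noteq> {}"
proof -
  show "map norm_cell (cells n L I n) = cells n (L - I) {} 0"
    by (simp add: cells_def cell_def norm_cell_def)
  show "1 \<in> set (cells n L I n) \<or> 3 \<in> set (cells n L I n) \<longleftrightarrow> L - I \<noteq> {}"
    using assms by (auto simp: cells_def cell_def image_iff split: if_splits)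
qed

lemma norm_cells_fresh:
  assumes "L \<subseteq> {..<n}"
  shows "map norm_cell (cells n L {} 0) = cells n L {} 0"
    and "1 \<in> set (cells n L {} 0) \<or> 3 \<in> set (cells n L {} 0) \<longleftrightarrow> L \<noteq> {}"
proof -
  show "map norm_cell (cells n L {} 0) = cells n L {} 0"
    by (simp add: cells_def cell_def norm_cell_def)
  show "1 \<in> set (cells n L {} 0) \<or> 3 \<in> set (cells n L {} 0) \<longleftrightarrow> L \<noteq> {}"
    using assms by (auto simp: cells_def cell_def image_iff split: if_splits)
qed

text \<open>While row \<open>u\<close> is read, tape 4 holds 1 once a neighbour of \<open>u\<close> in the independent set has been
  seen, and 2 once the cell of \<open>u\<close> itself, which is the first unreached one, has been updated.\<close>

definition row_cell :: "nat \<Rightarrow> nat \<Rightarrow> nat" where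
  "row_cell s r = (if r = 2 then s else if s = 1 then if r = 0 then 4 else 3
     else if s = 2 then 5 else s)"

definition row_reg :: "nat \<Rightarrow> nat \<Rightarrow> nat \<Rightarrow> nat" where
  "row_reg a s r = (if r = 2 \<or> s = 1 \<or> s = 2 then 2 else if s = 4 \<and> a = 2 then 1 else r)"

definition row_com :: com where
  "row_com = Do (acts [wr 4 0 St]) ;;
     While (\<lambda>s. s ! 2 \<noteq> 0)
       (Do (acts [mv Rt 0, (2, \<lambda>s. (row_cell (s ! 2) (s ! 4), Rt)),
                  (4, \<lambda>s. (row_reg (s ! 0) (s ! 2) (s ! 4), St))])) ;;
     rewind 2"

text \<open>The row and the work tape both have length \<open>n\<close> and are scanned in step, so
  the blank behind the work tape also signals the end of the row. When cell \<open>u\<close> is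
  reached, all chosen vertices lie to its left, and the register already tells whether one of them
  is a neighbour.\<close>

lemma runs_row_com:
  assumes "u < n"
  shows "runs row_com
    [tp (adj_list E n) (int (u * n)), t1, tp (cells n L (greedy E L u) u) 0, t3, tp [r] 0, t5]
    (6 * n + 9)
    [tp (adj_list E n) (int (Suc u * n)), t1, tp (cells n L (greedy E L (Suc u)) (Suc u)) 0, t3, tp [2] 0, t5]"
proof -
  let ?I = "greedy E L u" and ?J = "greedy E L (Suc u)"
  let ?step = "Do (acts [mv Rt 0, (2, \<lambda>s. (row_cell (s ! 2) (s ! 4), Rt)),
                  (4, \<lambda>s. (row_reg (s ! 0) (s ! 2) (s ! 4), St))])"
  define \<sigma> where "\<sigma> w = [tp (adj_list E n) (int (u * n + w)), t1,
    tp (if w \<le> u then cells n L ?I u else cells n L ?J (Suc u)) (int w), t3,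
    tp [if w \<le> u then if \<exists>w'<w. w' \<in> ?I \<and> E u w' then 1 else 0 else 2] 0, t5]" for w
  have IL: "?I \<subseteq> L \<inter> {..<u}" by (rule greedy_subset)
  have 1: "runs (Do (acts [wr 4 0 St]))
    [tp (adj_list E n) (int (u * n)), t1, tp (cells n L ?I u) 0, t3, tp [r] 0, t5] 1 (\<sigma> 0)"
    by (intro runs_acts) (simp add: wr_def \<sigma>_def)
  have 2: "runs (While (\<lambda>s. s ! 2 \<noteq> 0) ?step) (\<sigma> 0) (n * (1 + 2) + 1) (\<sigma> n)"
  proof (rule runs_While)
    fix w assume w: "w < n"
    then show "map scanned (\<sigma> w) ! 2 \<noteq> 0" by (simp add: \<sigma>_def scanned_tp)
    have upd: "(cells n L ?I u)[w := cell L ?I u w] = cells n L ?I u"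
      "(cells n L ?J (Suc u))[w := cell L ?J (Suc u) w] = cells n L ?J (Suc u)"
      using w by (metis list_update_id nth_cells)+
    have scan: "scanned (tp (adj_list E n) (int (u * n + w))) = (if E u w then 2 else 1)"
      using nth_adj_list[OF assms w] by (simp only: scanned_tp length_adj_list if_True)
    have move: "act (if E u w then 2 else 1, Rt) (tp (adj_list E n) (int (u * n + w))) =
        tp (adj_list E n) (int (u * n + Suc w))"
      using act_scanned_tp[of "adj_list E n" "int (u * n + w)" Rt] unfolding scan
      by (simp add: algebra_simps)
    \<comment> \<open>Left of \<open>u\<close> the marks are 3 to 5 and only the register can
      change; cell \<open>u\<close> is the first 1 or 2 and gets its mark; afterwards the register
      value 2 freezes everything.\<close>
    consider "w < u" | "w = u" | "u < w" by linarith
    then have "\<sigma> (Suc w) = [tp (adj_list E n) (int (u * n + Suc w)), t1,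
        act (row_cell (scanned (\<sigma> w ! 2)) (scanned (\<sigma> w ! 4)), Rt) (\<sigma> w ! 2), t3,
        act (row_reg (if E u w then 2 else 1) (scanned (\<sigma> w ! 2)) (scanned (\<sigma> w ! 4)), St) (\<sigma> w ! 4), t5]"
    proof cases
      case 1
      then have "row_cell (cell L ?I u w) x = cell L ?I u w" for x
        by (simp add: row_cell_def cell_def)
      moreover have "row_reg (if E u w then 2 else 1) (cell L ?I u w)
          (if \<exists>w'<w. w' \<in> ?I \<and> E u w' then 1 else 0) =
          (if \<exists>w'<Suc w. w' \<in> ?I \<and> E u w' then 1 else 0)"
        using 1 by (auto simp: row_reg_def cell_def less_Suc_eq)
      ultimately show ?thesis
        using 1 w by (simp add: \<sigma>_def scanned_tp act_tp upd add.commute)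
    next
      case 2
      have "(\<exists>w'<u. w' \<in> ?I \<and> E u w') \<longleftrightarrow> (\<exists>w'\<in>?I. E u w')"
        using IL by auto
      moreover have "(cells n L ?I u)[u := row_cell (cell L ?I u u)
          (if \<exists>w'\<in>?I. E u w' then 1 else 0)] = cells n L ?J (Suc u)"
        using IL assms
        by (intro nth_equalityI) (auto simp: nth_list_update row_cell_def cell_def less_Suc_eq)
      ultimately show ?thesis
        using 2 assms
        by (auto simp: \<sigma>_def scanned_tp act_tp row_reg_def cell_def add.commute simp del: greedy.simps)
    next
      case 3
      with w show ?thesis
        by (simp add: \<sigma>_def scanned_tp act_tp row_cell_def row_reg_def upd add.commute
            del: greedy.simps)
    qed
    then show "runs ?step (\<sigma> w) 1 (\<sigma> (Suc w))"
      by (intro runs_acts) (simp add: mv_def \<sigma>_def scan move del: greedy.simps of_nat_add of_nat_Suc of_nat_mult)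
  qed (simp add: \<sigma>_def scanned_tp)
  have 3: "runs (rewind 2) (\<sigma> n) (3 * n + 5)
    [tp (adj_list E n) (int (Suc u * n)), t1, tp (cells n L ?J (Suc u)) 0, t3, tp [2] 0, t5]"
    using assms by (intro runs_rewind_le[of _ _ "cells n L ?J (Suc u)" n])
      (simp_all add: \<sigma>_def zero_notin_cells algebra_simps del: greedy.simps)
  show ?thesis
    unfolding row_com_def by (rule runs_mono[OF runs_Seq[OF 1 runs_Seq[OF 2 3]]]) simp
qed

definition round_com :: com where
  "round_com = While (\<lambda>s. s ! 0 \<noteq> 0) row_com ;; rewind 0"

lemma runs_round_com:
  assumes "0 < n"
  shows "runs round_com
    [tp (adj_list E n) 0, t1, tp (cells n L {} 0) 0, t3, tp [r] 0, t5]
    (n * (6 * n + 11) + 3 * (n * n) + 7)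
    [tp (adj_list E n) 0, t1, tp (cells n L (greedy E L n) n) 0, t3, tp [2] 0, t5]"
proof -
  \<comment> \<open>Each row leaves the register at 2; only its value before the first row is
    arbitrary.\<close>
  define \<sigma> where "\<sigma> u = [tp (adj_list E n) (int (u * n)), t1, tp (cells n L (greedy E L u) u) 0, t3,
    tp [if u = 0 then r else 2] 0, t5]" for u
  have 1: "runs (While (\<lambda>s. s ! 0 \<noteq> 0) row_com) (\<sigma> 0) (n * ((6 * n + 9) + 2) + 1) (\<sigma> n)"
  proof (rule runs_While)
    fix u assume u: "u < n"
    have "adj_list E n ! (u * n) \<noteq> 0" "u * n < n * n"
      using nth_adj_list[OF u assms] by auto
    then show "map scanned (\<sigma> u) ! 0 \<noteq> 0"
      by (simp add: \<sigma>_def scanned_tp del: of_nat_mult)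
    show "runs row_com (\<sigma> u) (6 * n + 9) (\<sigma> (Suc u))"
      using runs_row_com[OF u] by (simp add: \<sigma>_def del: greedy.simps of_nat_mult)
  qed (simp add: \<sigma>_def scanned_tp del: of_nat_mult)
  have 2: "runs (rewind 0) (\<sigma> n) (3 * (n * n) + 5)
    [tp (adj_list E n) 0, t1, tp (cells n L (greedy E L n) n) 0, t3, tp [2] 0, t5]"
    using assms by (intro runs_rewind_le[of _ _ "adj_list E n" "n * n"])
      (simp_all add: \<sigma>_def zero_notin_adj_list)
  have "\<sigma> 0 = [tp (adj_list E n) 0, t1, tp (cells n L {} 0) 0, t3, tp [r] 0, t5]"
    by (simp add: \<sigma>_def)
  with runs_mono[OF runs_Seq[OF 1 2]] show ?thesis
    unfolding round_com_def by simp
qed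

section \<open>Counting the rounds\<close>

text \<open>Tape 1 tells which vertices are initially present (1) or removed (2), tape 2 is the work tape,
  tape 3 counts the rounds in unary, and tape 4 is 0 iff no vertex is left.\<close>

definition copy_com :: com where
  "copy_com = While (\<lambda>s. s ! 1 \<noteq> 0) (Do (acts [mv Rt 1, (2, \<lambda>s. (s ! 1, Rt))])) ;;
     rewind 1 ;; rewind 2"

text \<open>The bound on \<open>length ss\<close> covers both the blank work tape of the first use
  and the \<open>n\<close> cells left by later ones.\<close>

lemma runs_copy_com:
  assumes "length ds = n" and "0 \<notin> set ds" and "length ss \<le> n"
  shows "runs copy_com [t0, tp ds 0, tp ss 0, t3, t4, t5] (9 * n + 13)
    [t0, tp ds 0, tp ds 0, t3, t4, t5]"
proof -
  define \<sigma> where "\<sigma> i = [t0, tp ds (int i), tp (take i ds @ drop i ss) (int i), t3, t4, t5]" for i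
  have 1: "runs (While (\<lambda>s. s ! 1 \<noteq> 0) (Do (acts [mv Rt 1, (2, \<lambda>s. (s ! 1, Rt))])))
    (\<sigma> 0) (n * (1 + 2) + 1) (\<sigma> n)"
  proof (rule runs_While)
    fix i assume i: "i < n"
    then have "ds ! i \<noteq> 0" using assms nth_mem by metis
    with i assms(1) show "map scanned (\<sigma> i) ! 1 \<noteq> 0"
      by (simp add: \<sigma>_def scanned_tp)
    show "runs (Do (acts [mv Rt 1, (2, \<lambda>s. (s ! 1, Rt))])) (\<sigma> i) 1 (\<sigma> (Suc i))"
      using i assms(1)
      by (intro runs_acts)
        (simp add: \<sigma>_def mv_def scanned_tp act_tp act_tp_write take_Suc_conv_app_nth add.commute min_def)
  qed (use assms(1) in \<open>simp add: \<sigma>_def scanned_tp\<close>)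
  have 2: "runs (rewind 1) (\<sigma> n) (3 * n + 5) [t0, tp ds 0, tp ds (int n), t3, t4, t5]"
    using assms by (intro runs_rewind_le[of _ _ ds n]) (simp_all add: \<sigma>_def)
  have 3: "runs (rewind 2) [t0, tp ds 0, tp ds (int n), t3, t4, t5] (3 * n + 5)
    [t0, tp ds 0, tp ds 0, t3, t4, t5]"
    using assms by (intro runs_rewind_le[of _ _ ds n]) simp_all
  have "\<sigma> 0 = [t0, tp ds 0, tp ss 0, t3, t4, t5]" by (simp add: \<sigma>_def)
  with runs_mono[OF runs_Seq[OF 1 runs_Seq[OF 2 3]]] show ?thesis
    unfolding copy_com_def by simp
qed

definition rounds_com :: com where
  "rounds_com = copy_com ;; norm_com ;;
     While (\<lambda>s. s ! 4 \<noteq> 0) (round_com ;; norm_com ;; Do (acts [wr 3 1 Rt]))"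

text \<open>The factor \<open>n\<close> bounds the number of rounds; the linear part pays for
  copying and the first normalisation.\<close>

definition rounds_time :: "nat \<Rightarrow> nat" where
  "rounds_time n = 15 * n + 25 + n * (n * (6 * n + 11) + 3 * (n * n) + 6 * n + 21)"

lemma max_clique_le: "max_clique E L \<le> n" if "L \<subseteq> {..<n}" for L :: "nat set"
proof -
  have "finite L" using that finite_subset by blast
  then obtain K where "K \<subseteq> L" "card K = max_clique E L"
    using max_clique_witness by metis
  with that card_mono[of "{..<n}" K] show ?thesis by auto
qed

text \<open>The counter writes ones and never erases, so the \<open>m\<close> ones of an earlier run
  survive and only the head position shows the new clique number. Two clique numbers can then be
  compared by looking at the cell under the head.\<close>

lemma runs_rounds_com:
  assumes sym: "\<And>x y. E x y \<Longrightarrow> E y x" and cis: "\<And>L. L \<subseteq> {..<n} \<Longrightarrow> cis_on E L"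
    and "0 < n" and L: "L \<subseteq> {..<n}" and "length ss \<le> n"
  shows "runs rounds_com
    [tp (adj_list E n) 0, tp (cells n L {} 0) 0, tp ss 0, tp (replicate m 1) 0, tp [r] 0, t5]
    (rounds_time n)
    [tp (adj_list E n) 0, tp (cells n L {} 0) 0, tp (cells n {} {} 0) 0,
     tp (replicate (max m (max_clique E L)) 1) (int (max_clique E L)), tp [0] 0, t5]"
proof -
  define A where "A k = ((\<lambda>L. L - greedy E L n) ^^ k) L" for k
  define \<sigma> where "\<sigma> k = [tp (adj_list E n) 0, tp (cells n L {} 0) 0, tp (cells n (A k) {} 0) 0,
    tp (replicate (max m k) 1) (int k), tp [if A k \<noteq> {} then 1 else 0] 0, t5]" for k
  let ?q = "max_clique E L"
  have A_Suc: "A (Suc k) = A k - greedy E (A k) n" for k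
    by (simp add: A_def)
  have A_subset: "A k \<subseteq> {..<n}" for k
    by (induction k) (use L in \<open>auto simp: A_def\<close>)
  have finA: "finite (A k)" for k
    using A_subset finite_subset by blast
  have clique_A: "max_clique E (A k) = ?q - k" if "k \<le> ?q" for k
    using that
  proof (induction k)
    case (Suc k)
    then have "A k \<noteq> {}" using max_clique_eq_0_iff[OF finA, of E k] by auto
    with max_clique_diff_greedy[OF sym A_subset _ cis[OF A_subset], of k] Suc show ?case
      by (simp add: A_Suc)
  qed (simp add: A_def)
  have A_empty: "A k = {} \<longleftrightarrow> k = ?q" if "k \<le> ?q" for k
    using max_clique_eq_0_iff[OF finA, of E k] clique_A[OF that] that by auto
  have 1: "runs copy_com
    [tp (adj_list E n) 0, tp (cells n L {} 0) 0, tp ss 0, tp (replicate m 1) 0, tp [r] 0, t5]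
    (9 * n + 13)
    [tp (adj_list E n) 0, tp (cells n L {} 0) 0, tp (cells n L {} 0) 0, tp (replicate m 1) 0, tp [r] 0, t5]"
    using assms by (intro runs_copy_com) (simp_all add: zero_notin_cells)
  have 2: "runs norm_com
    [tp (adj_list E n) 0, tp (cells n L {} 0) 0, tp (cells n L {} 0) 0, tp (replicate m 1) 0, tp [r] 0, t5]
    (6 * n + 9) (\<sigma> 0)"
    using runs_norm_com[of "cells n L {} 0" n] zero_notin_cells norm_cells_fresh[OF L]
    by (simp add: \<sigma>_def A_def)
  have 3: "runs (While (\<lambda>s. s ! 4 \<noteq> 0) (round_com ;; norm_com ;; Do (acts [wr 3 1 Rt])))
    (\<sigma> 0) (?q * ((n * (6 * n + 11) + 3 * (n * n) + 6 * n + 19) + 2) + 1) (\<sigma> ?q)"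
  proof (rule runs_While)
    fix k assume k: "k < ?q"
    then show "map scanned (\<sigma> k) ! 4 \<noteq> 0"
      using A_empty[of k] by (simp add: \<sigma>_def)
    define r1 where "r1 = [tp (adj_list E n) 0, tp (cells n L {} 0) 0,
      tp (cells n (A k) (greedy E (A k) n) n) 0, tp (replicate (max m k) 1) (int k), tp [2] 0, t5]"
    define r2 where "r2 = [tp (adj_list E n) 0, tp (cells n L {} 0) 0,
      tp (cells n (A (Suc k)) {} 0) 0, tp (replicate (max m k) 1) (int k),
      tp [if A (Suc k) \<noteq> {} then 1 else 0] 0, t5]"
    have 1: "runs round_com (\<sigma> k) (n * (6 * n + 11) + 3 * (n * n) + 7) r1"
      unfolding \<sigma>_def r1_def by (rule runs_round_com) fact
    have 2: "runs norm_com r1 (6 * n + 9) r2"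
      using runs_norm_com[of "cells n (A k) (greedy E (A k) n) n" n] zero_notin_cells
        norm_cells[OF A_subset]
      by (simp add: r1_def r2_def A_Suc)
    \<comment> \<open>Either an old one is overwritten by a one, or the block grows by a
      cell.\<close>
    have "act (1, Rt) (tp (replicate (max m k) 1) (int k)) =
        tp (replicate (max m (Suc k)) 1) (int (Suc k))"
    proof (cases "k < m")
      case True
      moreover from this have "(replicate m 1)[k := 1] = replicate m (1::nat)"
        by (metis list_update_id nth_replicate)
      moreover from True have "max m k = m" "max m (Suc k) = m" by auto
      ultimately show ?thesis by (simp add: act_tp add.commute)
    next
      case False
      then show ?thesis
        by (simp add: act_tp_write max_def replicate_append_same add.commute flip: replicate_Suc)
    qed
    then have 3: "runs (Do (acts [wr 3 1 Rt])) r2 1 (\<sigma> (Suc k))"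
      by (intro runs_acts) (simp add: r2_def \<sigma>_def wr_def del: of_nat_Suc)
    show "runs (round_com ;; norm_com ;; Do (acts [wr 3 1 Rt])) (\<sigma> k)
        (n * (6 * n + 11) + 3 * (n * n) + 6 * n + 19) (\<sigma> (Suc k))"
      by (rule runs_mono[OF runs_Seq[OF 1 runs_Seq[OF 2 3]]]) simp
  qed (use A_empty[of ?q] in \<open>simp add: \<sigma>_def\<close>)
  have "runs rounds_com
    [tp (adj_list E n) 0, tp (cells n L {} 0) 0, tp ss 0, tp (replicate m 1) 0, tp [r] 0, t5]
    (rounds_time n) (\<sigma> ?q)"
    unfolding rounds_com_def
  proof (rule runs_mono[OF runs_Seq[OF 1 runs_Seq[OF 2 3]]])
    show "9 * n + 13 + (6 * n + 9 +
        (?q * ((n * (6 * n + 11) + 3 * (n * n) + 6 * n + 19) + 2) + 1) + 1) + 1 \<le> rounds_time n"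
    proof -
      define c where "c = n * (6 * n + 11) + 3 * (n * n) + 6 * n + 21"
      have "n * (6 * n + 11) + 3 * (n * n) + 6 * n + 19 + 2 = c" by (simp add: c_def)
      moreover have "?q * c \<le> n * c" using max_clique_le[OF L] by (rule mult_le_mono1)
      ultimately show ?thesis unfolding rounds_time_def c_def[symmetric] by simp
    qed
  qed
  moreover have "A ?q = {}" using A_empty by simp
  ultimately show ?thesis by (simp add: \<sigma>_def)
qed

section \<open>The whole program\<close>

text \<open>Tape 1 marks the vertex \<open>v\<close> that is removed. After the first run, tape 3 holds \<open>\<omega> G\<close> in unary, so
  that its head is on a non-blank cell after a run on \<open>G - v\<close> iff \<open>v\<close> is in every maximum clique.
  Tape 5 counts these vertices up to 2.\<close>

definition mark_com :: com where
  "mark_com = Do (acts [(1, \<lambda>s. (if s ! 1 = 0 then 0 else 2, St))])"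

text \<open>For \<open>v = n\<close> the head is behind the word and the blank stays a blank; this
  ends the loop of \<open>stability_com\<close>.\<close>

lemma runs_mark_com:
  "runs mark_com [t0, tp (cells n {..<n} {} 0) (int v), t2, t3, t4, t5] 1
     [t0, tp (cells n ({..<n} - {v}) {} 0) (int v), t2, t3, t4, t5]" if "v \<le> n"
proof (cases "v < n")
  case True
  then have "(cells n {..<n} {} 0)[v := 2] = cells n ({..<n} - {v}) {} 0"
    by (intro nth_equalityI) (auto simp: nth_list_update cell_def)
  with True show ?thesis
    unfolding mark_com_def by (intro runs_acts) (simp add: scanned_tp act_tp cell_def)
next
  case False
  with that have v: "v = n" by simp
  moreover have "act (0, St) (tp (cells n {..<n} {} 0) (int n)) = tp (cells n {..<n} {} 0) (int n)"
    using act_scanned_tp[of "cells n {..<n} {} 0" "int n" St] by (simp add: scanned_tp)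
  ultimately show ?thesis
    unfolding mark_com_def by (intro runs_acts) (simp add: scanned_tp)
qed

text \<open>The rounds need tape 1 rewound, which loses the position of \<open>v\<close>; it is
  found again as the only cell holding 2, restored to 1, and the mark moves on.\<close>

definition test_com :: com where
  "test_com = rewind 1 ;; rounds_com ;;
     Do (acts [(5, \<lambda>s. (if s ! 3 \<noteq> 0 \<and> s ! 5 < 2 then s ! 5 + 1 else s ! 5, St))]) ;;
     rewind 3 ;; While (\<lambda>s. s ! 1 \<noteq> 2) (Do (acts [mv Rt 1])) ;;
     Do (acts [wr 1 1 Rt]) ;; mark_com"

definition stability_com :: com where
  "stability_com = count_com ;; rewind 0 ;; rounds_com ;; rewind 3 ;; mark_com ;;
     While (\<lambda>s. s ! 1 \<noteq> 0) test_com"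

definition stability_time :: "nat \<Rightarrow> nat" where
  "stability_time n = n * (6 * n + 11) + 3 * (n * n) + rounds_time n + 3 * n + 18 +
     n * (9 * n + rounds_time n + 22)"

lemma runs_stability_com:
  assumes sym: "\<And>x y. E x y \<Longrightarrow> E y x" and cis: "\<And>L. L \<subseteq> {..<n} \<Longrightarrow> cis_on E L"
    and "0 < n"
  shows "\<exists>t0 t1 t2 t3 t4. runs stability_com
    [tp (adj_list E n) 0, tp [] 0, tp [] 0, tp [] 0, tp [0] 0, tp [0] 0] (stability_time n)
    [t0, t1, t2, t3, t4, tp [min 2 (card (core E {..<n}))] 0]"
proof -
  let ?V = "{..<n}" and ?in = "tp (adj_list E n)" and ?S = "tp (cells n {} {} 0) 0"
  define k where "k = max_clique E ?V"
  define W where "W i = tp (replicate k 1) (int i)" for i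
  define C where "C v = card (core E ?V \<inter> {..<v})" for v
  define \<sigma> where "\<sigma> v = [?in 0, tp (cells n (?V - {v}) {} 0) (int v), ?S, W 0, tp [0] 0, tp [min 2 (C v)] 0]" for v
  have kn: "k \<le> n" unfolding k_def by (rule max_clique_le) simp
  \<comment> \<open>The unary counter produced by \<open>count_com\<close> is at the same time the
    code of the full vertex set.\<close>
  have V: "replicate n 1 = cells n ?V {} 0"
    by (intro nth_equalityI) (simp_all add: cell_def)
  have 1: "runs count_com [?in 0, tp [] 0, tp [] 0, tp [] 0, tp [0] 0, tp [0] 0] (n * (6 * n + 11) + 1)
      [?in (int (n * n)), tp (cells n ?V {} 0) 0, tp [] 0, tp [] 0, tp [0] 0, tp [0] 0]"
    unfolding V[symmetric] by (rule runs_count_com) (simp_all add: zero_notin_adj_list)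
  have 2: "runs (rewind 0) [?in (int (n * n)), tp (cells n ?V {} 0) 0, tp [] 0, tp [] 0, tp [0] 0, tp [0] 0]
      (3 * (n * n) + 5) [?in 0, tp (cells n ?V {} 0) 0, tp [] 0, tp [] 0, tp [0] 0, tp [0] 0]"
    by (intro runs_rewind_le[of _ _ "adj_list E n" "n * n"]) (simp_all add: zero_notin_adj_list)
  have 3: "runs rounds_com [?in 0, tp (cells n ?V {} 0) 0, tp [] 0, tp [] 0, tp [0] 0, tp [0] 0]
      (rounds_time n) [?in 0, tp (cells n ?V {} 0) 0, ?S, W k, tp [0] 0, tp [0] 0]"
    using runs_rounds_com[OF sym cis \<open>0 < n\<close>, of ?V "[]" 0 0 "tp [0] 0"] by (simp add: k_def W_def)
  have 4: "runs (rewind 3) [?in 0, tp (cells n ?V {} 0) 0, ?S, W k, tp [0] 0, tp [0] 0]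
      (3 * n + 5) [?in 0, tp (cells n ?V {} 0) 0, ?S, W 0, tp [0] 0, tp [0] 0]"
    using kn by (intro runs_rewind_le[of _ _ "replicate k 1" k]) (simp_all add: W_def)
  have 5: "runs mark_com [?in 0, tp (cells n ?V {} 0) 0, ?S, W 0, tp [0] 0, tp [0] 0] 1 (\<sigma> 0)"
    using runs_mark_com[of 0 n] by (simp add: \<sigma>_def C_def)
  have 6: "runs (While (\<lambda>s. s ! 1 \<noteq> 0) test_com) (\<sigma> 0) (n * ((9 * n + rounds_time n + 20) + 2) + 1) (\<sigma> n)"
  proof (rule runs_While)
    fix v assume v: "v < n"
    let ?D = "cells n (?V - {v}) {} 0" and ?q = "max_clique E (?V - {v})"
    from v show "map scanned (\<sigma> v) ! 1 \<noteq> 0" by (simp add: \<sigma>_def scanned_tp)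
    have qk: "?q \<le> k" unfolding k_def by (intro max_clique_mono) auto
    have 1: "runs (rewind 1) (\<sigma> v) (3 * n + 5) [?in 0, tp ?D 0, ?S, W 0, tp [0] 0, tp [min 2 (C v)] 0]"
      using v by (intro runs_rewind_le[of _ _ ?D v]) (simp_all add: \<sigma>_def zero_notin_cells)
    have 2: "runs rounds_com [?in 0, tp ?D 0, ?S, W 0, tp [0] 0, tp [min 2 (C v)] 0] (rounds_time n)
        [?in 0, tp ?D 0, ?S, W ?q, tp [0] 0, tp [min 2 (C v)] 0]"
      using runs_rounds_com[OF sym cis \<open>0 < n\<close>, of "?V - {v}" "cells n {} {} 0" k 0 "tp [min 2 (C v)] 0"] qk
      by (simp add: W_def max_def)
    have 3: "runs (Do (acts [(5, \<lambda>s. (if s ! 3 \<noteq> 0 \<and> s ! 5 < 2 then s ! 5 + 1 else s ! 5, St))]))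
        [?in 0, tp ?D 0, ?S, W ?q, tp [0] 0, tp [min 2 (C v)] 0] 1
        [?in 0, tp ?D 0, ?S, W ?q, tp [0] 0, tp [min 2 (C (Suc v))] 0]"
    proof -
      \<comment> \<open>The head of tape 3 stands at \<open>?q\<close> in a block of
        \<open>k\<close> ones, so it scans a non-blank exactly if \<open>?q < k\<close>, that is, if
        \<open>v\<close> is in the core.\<close>
      have "core E ?V \<inter> {..<Suc v} =
          (if ?q < k then insert v (core E ?V \<inter> {..<v}) else core E ?V \<inter> {..<v})"
        using v by (auto simp: core_def k_def less_Suc_eq)
      then have "C (Suc v) = (if ?q < k then Suc (C v) else C v)"
        by (simp add: C_def)
      moreover define c where "c = min 2 (C v)"
      ultimately have "min 2 (C (Suc v)) = (if ?q < k \<and> c < 2 then c + 1 else c)"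
        by auto
      then show ?thesis
        unfolding c_def[symmetric] by (intro runs_acts) (simp add: W_def scanned_tp)
    qed
    have 4: "runs (rewind 3) [?in 0, tp ?D 0, ?S, W ?q, tp [0] 0, tp [min 2 (C (Suc v))] 0]
        (3 * n + 5) [?in 0, tp ?D 0, ?S, W 0, tp [0] 0, tp [min 2 (C (Suc v))] 0]"
      using kn qk by (intro runs_rewind_le[of _ _ "replicate k 1" ?q]) (simp_all add: W_def)
    define \<rho> where "\<rho> j = [?in 0, tp ?D (int j), ?S, W 0, tp [0] 0, tp [min 2 (C (Suc v))] 0]" for j
    have 5: "runs (While (\<lambda>s. s ! 1 \<noteq> 2) (Do (acts [mv Rt 1]))) (\<rho> 0) (v * (1 + 2) + 1) (\<rho> v)"
    proof (rule runs_While)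
      fix j assume "j < v"
      with v show "map scanned (\<rho> j) ! 1 \<noteq> 2" by (simp add: \<rho>_def scanned_tp cell_def)
      show "runs (Do (acts [mv Rt 1])) (\<rho> j) 1 (\<rho> (Suc j))"
        by (intro runs_acts) (simp add: \<rho>_def mv_def add.commute)
    qed (use v in \<open>simp add: \<rho>_def scanned_tp cell_def\<close>)
    have "?D[v := 1] = cells n ?V {} 0"
      using v by (intro nth_equalityI) (auto simp: nth_list_update cell_def)
    with v have 6: "runs (Do (acts [wr 1 1 Rt])) (\<rho> v) 1
        [?in 0, tp (cells n ?V {} 0) (int (Suc v)), ?S, W 0, tp [0] 0, tp [min 2 (C (Suc v))] 0]"
      by (intro runs_acts) (simp add: \<rho>_def wr_def act_tp add.commute)
    have 7: "runs mark_com [?in 0, tp (cells n ?V {} 0) (int (Suc v)), ?S, W 0, tp [0] 0, tp [min 2 (C (Suc v))] 0]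
        1 (\<sigma> (Suc v))"
      unfolding \<sigma>_def using v by (intro runs_mark_com) simp
    have \<rho>: "\<rho> 0 = [?in 0, tp ?D 0, ?S, W 0, tp [0] 0, tp [min 2 (C (Suc v))] 0]"
      by (simp add: \<rho>_def)
    show "runs test_com (\<sigma> v) (9 * n + rounds_time n + 20) (\<sigma> (Suc v))"
      unfolding test_com_def using v
      by (intro runs_mono[OF runs_Seq[OF 1 runs_Seq[OF 2 runs_Seq[OF 3
            runs_Seq[OF 4[folded \<rho>] runs_Seq[OF 5 runs_Seq[OF 6 7]]]]]]]) simp
  qed (simp add: \<sigma>_def scanned_tp)
  have "runs stability_com [?in 0, tp [] 0, tp [] 0, tp [] 0, tp [0] 0, tp [0] 0] (stability_time n) (\<sigma> n)"
    unfolding stability_com_def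
    by (rule runs_mono[OF runs_Seq[OF 1 runs_Seq[OF 2 runs_Seq[OF 3 runs_Seq[OF 4 runs_Seq[OF 5 6]]]]]])
      (simp add: stability_time_def algebra_simps)
  moreover have "core E ?V \<inter> ?V = core E ?V" by (auto simp: core_def)
  ultimately have "runs stability_com [?in 0, tp [] 0, tp [] 0, tp [] 0, tp [0] 0, tp [0] 0] (stability_time n)
      [?in 0, tp (cells n (?V - {n}) {} 0) (int n), ?S, W 0, tp [0] 0, tp [min 2 (card (core E ?V))] 0]"
    by (simp add: \<sigma>_def C_def)
  then show ?thesis by blast
qed

text \<open>The six symbols are the blank and the five marks of the work tape; registers stay at
  most 2.\<close>

lemma wf_stability_com: "wf_com 6 6 stability_com"
  unfolding stability_com_def test_com_def mark_com_def rounds_com_def round_com_def row_com_def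
    norm_com_def copy_com_def count_com_def rewind_def mv_def wr_def
  by (simp add: wf_acts_acts row_cell_def row_reg_def norm_cell_def)

text \<open>The input has length \<open>n * n\<close>, so bounds must be polynomials in that number.
  Since \<open>n \<le> n * n\<close>, the identity is bounded, and bounded functions are closed
  under sums and products.\<close>

lemma stability_time_poly: "\<exists>p :: nat poly. \<forall>n. stability_time n \<le> poly p (n * n)"
proof -
  define bounded where "bounded f \<longleftrightarrow> (\<exists>p :: nat poly. \<forall>n. f n \<le> poly p (n * n))" for f :: "nat \<Rightarrow> nat"
  have const: "bounded (\<lambda>_. c)" for c
    unfolding bounded_def by (intro exI[of _ "[:c:]"]) simp
  have id: "bounded (\<lambda>n. n)"
    unfolding bounded_def by (intro exI[of _ "[:0, 1:]"]) simp
  have add: "bounded (\<lambda>n. f n + g n)" if "bounded f" "bounded g" for f g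
  proof -
    from that obtain p q :: "nat poly" where "\<forall>n. f n \<le> poly p (n * n)" "\<forall>n. g n \<le> poly q (n * n)"
      by (auto simp: bounded_def)
    then show ?thesis
      unfolding bounded_def by (intro exI[of _ "p + q"]) (simp add: add_mono)
  qed
  have mult: "bounded (\<lambda>n. f n * g n)" if "bounded f" "bounded g" for f g
  proof -
    from that obtain p q :: "nat poly" where "\<forall>n. f n \<le> poly p (n * n)" "\<forall>n. g n \<le> poly q (n * n)"
      by (auto simp: bounded_def)
    then show ?thesis
      unfolding bounded_def by (intro exI[of _ "p * q"]) (simp add: mult_le_mono)
  qed
  have "bounded stability_time"
    unfolding stability_time_def[abs_def] rounds_time_def by (intro add mult const id)
  then show ?thesis by (simp add: bounded_def)
qed

section \<open>Adjacency codes of co-graphs\<close>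

lemma concat_map_upt:
  "concat (map (\<lambda>u. map (f u) [0..<n]) [0..<m]) = map (\<lambda>i. f (i div n) (i mod n)) [0..<m * n]"
proof (induction m)
  case (Suc m)
  let ?g = "\<lambda>i. f (i div n) (i mod n)"
  have row: "map (f m) [0..<n] = map ?g [m * n..<m * n + n]"
    by (intro nth_equalityI) simp_all
  have "concat (map (\<lambda>u. map (f u) [0..<n]) [0..<Suc m]) =
      concat (map (\<lambda>u. map (f u) [0..<n]) [0..<m]) @ map (f m) [0..<n]"
    by simp
  also have "\<dots> = map ?g ([0..<m * n] @ [m * n..<m * n + n])"
    by (simp only: Suc.IH row map_append)
  also have "[0..<m * n] @ [m * n..<m * n + n] = [0..<Suc m * n]"
    using upt_add_eq_append[of 0 "m * n" n] by (simp add: add.commute)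
  finally show ?case .
qed simp

lemma adjacency_code_eq:
  "map (\<lambda>b. if b then 2 else 1) (adjacency_code vs G) =
     adj_list (\<lambda>i j. adjacent G (vs ! i) (vs ! j)) (length vs)"
proof -
  have "adjacency_code vs G = concat (map (\<lambda>u. map (\<lambda>v. adjacent G (vs ! u) (vs ! v)) [0..<length vs]) [0..<length vs])"
    unfolding adjacency_code_def
    by (subst (2) map_nth[symmetric], subst (4) map_nth[symmetric]) (simp add: o_def)
  then show ?thesis
    unfolding concat_map_upt by (simp add: adj_list_def o_def)
qed

lemma cograph_nonempty: "cograph G \<Longrightarrow> verts G \<noteq> {}"
  by (induction rule: cograph.induct) (auto simp: graph_union_def graph_join_def)

lemma init_tapes:
  "input_tape x # replicate (6 - 1) (0, \<lambda>_. 0) =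
     [tp (map (\<lambda>b. if b then 2 else 1) x) 0, tp [] 0, tp [] 0, tp [] 0, tp [0] 0, tp [0] 0]"
proof -
  have "tp [] 0 = (0, \<lambda>_. 0)" "tp [0] 0 = (0, \<lambda>_. 0)"
    by (auto simp: tp_def)
  moreover have "input_tape x = tp (map (\<lambda>b. if b then 2 else 1) x) 0"
    by (auto simp: input_tape_def tp_def fun_eq_iff nat_less_iff)
  ultimately show ?thesis by (simp add: eval_nat_numeral)
qed

theorem theorem20:
  shows "in_P_for graph_codes (omega_stability :: nat graph set) {G. cograph G}"
proof -
  obtain p :: "nat poly" where p: "\<And>n. stability_time n \<le> poly p (n * n)"
    using stability_time_poly by blast
  have "\<exists>ts. runs stability_com (input_tape x # replicate (6 - 1) (0, \<lambda>_. 0)) (poly p (length x)) ts \<and>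
      (map scanned ts ! 5 \<le> 1) = (G \<in> omega_stability)"
    if Gx: "G \<in> {G. cograph G}" "x \<in> graph_codes G" for G :: "nat graph" and x
  proof -
    obtain vs where vs: "distinct vs" "set vs = verts G" "x = adjacency_code vs G"
      using Gx(2) by (auto simp: graph_codes_def)
    define n where "n = length vs"
    \<comment> \<open>From here on vertices are replaced by their positions in the unknown order
      \<open>vs\<close> behind the code.\<close>
    define E where "E = (\<lambda>i j. adjacent G (vs ! i) (vs ! j))"
    from Gx have G: "cograph G" by simp
    have inj: "inj_on ((!) vs) {..<n}"
      using vs(1) by (simp add: inj_on_def n_def nth_eq_iff_index_eq)
    have img: "(!) vs ` {..<n} = verts G"
      unfolding vs(2)[symmetric] by (auto simp: n_def set_conv_nth)
    have n: "0 < n" using cograph_nonempty[OF G] vs(2) by (auto simp: n_def)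
    have code: "map (\<lambda>b. if b then 2 else 1) x = adj_list E n"
      using adjacency_code_eq vs(3) by (simp add: E_def n_def)
    then have len: "length x = n * n"
      by (metis length_adj_list length_map)
    have "cis_on E L" if "L \<subseteq> {..<n}" for L
      unfolding E_def
    proof (rule cis_image)
      show "inj_on ((!) vs) L" using inj that by (rule inj_on_subset)
      show "cis_on (adjacent G) ((!) vs ` L)"
        using G img that by (intro cograph_cis) auto
    qed
    moreover have "E i j \<Longrightarrow> E j i" for i j by (simp add: E_def insert_commute)
    ultimately obtain t0 t1 t2 t3 t4 where
      "runs stability_com (input_tape x # replicate (6 - 1) (0, \<lambda>_. 0)) (stability_time n)
        [t0, t1, t2, t3, t4, tp [min 2 (card (core E {..<n}))] 0]"
      unfolding init_tapes code using runs_stability_com[of E n] n by blast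
    moreover have "card (core E {..<n}) = card (core (adjacent G) (verts G))"
      using card_core_image[OF inj, of "adjacent G"] by (simp add: img E_def)
    ultimately show ?thesis
      using runs_mono p[of n] omega_stability_iff[OF cograph_simple_graph[OF G]]
      by (intro exI[of _ "[t0, t1, t2, t3, t4, tp [min 2 (card (core E {..<n}))] 0]"])
        (auto simp: len)
  qed
  \<comment> \<open>Capping the count on tape 5 at 2 does not affect whether it is at most
    1.\<close>
  then show ?thesis
    by (intro in_P_for_com[where verdict = "\<lambda>s. s ! 5 \<le> 1", OF wf_stability_com]) simp_all
qed

end
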